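(* Let $G$ be a $5$-regular graph that has no $(4,1)$-coloring, and which is vertex-minimal with this property (every $5$-regular graph with fewer vertices than $G$ has a $(4,1)$-coloring). Then: (a) $G$ is connected. (b) $G$ is not $4$-edge-connected, i.e., $G$ contains an edge cut on $3$ edges. (c) $G$ has no minimal edge cut of size $2$. (d) $G$ does not have two bridges. (e) Each bridge in $G$ has precisely one endpoint incident to two loops. (f) The edges of any minimal edge cut of size $3$ in $G$ have a vertex in common, and this vertex is incident to a loop.
   Context: All graphs are finite, undirected pseudographs (multiple edges and loops allowed; a loop contributes $2$ to the degree). A $(4,1)$-coloring of a $5$-regular graph is an edge-coloring using at least two colors such that every vertex is incident to exactly $4$ edges of one color and exactly $1$ edge of a different color. A set $S$ of edges of a connected graph $G$ is an edge cut if $G-S$ is disconnected; it is minimal if $G-(S\setminus\{e\})$ is connected for every $e\in S$. A bridge is an edge cut of size $1$. *)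

theory Defs
  imports Main "HOL-Library.Multiset"
begin

text \<open>
  An edge is mapped to the two-element multiset of its endpoints; a loop at \<open>v\<close> is mapped to
  \<open>{#v, v#}\<close>. Summing multiplicities over edges therefore counts every loop twice, both in the
  degree and in the number of edges of a given colour at a vertex.
\<close>

record ('v, 'e) pgraph =
  verts :: "'v set"
  edges :: "'e set"
  ends :: "'e \<Rightarrow> 'v multiset"

text \<open>
  Graphs are nonempty. The null graph would vacuously be 5-regular with no colouring that uses
  two colours, hence a degenerate vertex-minimal example.
\<close>

definition pseudograph :: "('v, 'e) pgraph \<Rightarrow> bool" where
  "pseudograph G \<longleftrightarrow>
     finite (verts G) \<and> verts G \<noteq> {} \<and> finite (edges G) \<and>
     (\<forall>e\<in>edges G. size (ends G e) = 2 \<and> set_mset (ends G e) \<subseteq> verts G)"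

definition degree :: "('v, 'e) pgraph \<Rightarrow> 'v \<Rightarrow> nat" where
  "degree G v = (\<Sum>e\<in>edges G. count (ends G e) v)"

definition regular :: "nat \<Rightarrow> ('v, 'e) pgraph \<Rightarrow> bool" where
  "regular k G \<longleftrightarrow> (\<forall>v\<in>verts G. degree G v = k)"

definition color_degree :: "('v, 'e) pgraph \<Rightarrow> ('e \<Rightarrow> 'c) \<Rightarrow> 'c \<Rightarrow> 'v \<Rightarrow> nat" where
  "color_degree G c a v = (\<Sum>e\<in>{e \<in> edges G. c e = a}. count (ends G e) v)"

definition is_41_coloring :: "('v, 'e) pgraph \<Rightarrow> ('e \<Rightarrow> 'c) \<Rightarrow> bool" where
  "is_41_coloring G c \<longleftrightarrow>
     card (c ` edges G) \<ge> 2 \<and>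
     (\<forall>v\<in>verts G. \<exists>a b. a \<noteq> b \<and> color_degree G c a v = 4 \<and> color_degree G c b v = 1)"

text \<open>The number of colours is not bounded; as edge sets are finite, colours in \<open>nat\<close> suffice.\<close>

definition has_41_coloring :: "('v, 'e) pgraph \<Rightarrow> bool" where
  "has_41_coloring G \<longleftrightarrow> (\<exists>c :: 'e \<Rightarrow> nat. is_41_coloring G c)"

definition adjacency :: "('v, 'e) pgraph \<Rightarrow> ('v \<times> 'v) set" where
  "adjacency G = {(u, v). \<exists>e\<in>edges G. ends G e = {#u, v#}}"

definition connected_graph :: "('v, 'e) pgraph \<Rightarrow> bool" where
  "connected_graph G \<longleftrightarrow>
     verts G \<noteq> {} \<and> (\<forall>u\<in>verts G. \<forall>v\<in>verts G. (u, v) \<in> (adjacency G)\<^sup>*)"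

definition delete_edges :: "('v, 'e) pgraph \<Rightarrow> 'e set \<Rightarrow> ('v, 'e) pgraph" where
  "delete_edges G S = G\<lparr>edges := edges G - S\<rparr>"

definition edge_cut :: "('v, 'e) pgraph \<Rightarrow> 'e set \<Rightarrow> bool" where
  "edge_cut G S \<longleftrightarrow>
     connected_graph G \<and> S \<subseteq> edges G \<and> \<not> connected_graph (delete_edges G S)"

definition minimal_edge_cut :: "('v, 'e) pgraph \<Rightarrow> 'e set \<Rightarrow> bool" where
  "minimal_edge_cut G S \<longleftrightarrow>
     edge_cut G S \<and> (\<forall>e\<in>S. connected_graph (delete_edges G (S - {e})))"

definition bridge :: "('v, 'e) pgraph \<Rightarrow> 'e \<Rightarrow> bool" where
  "bridge G e \<longleftrightarrow> edge_cut G {e}"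

definition edge_connected :: "nat \<Rightarrow> ('v, 'e) pgraph \<Rightarrow> bool" where
  "edge_connected k G \<longleftrightarrow>
     card (verts G) \<ge> 2 \<and>
     (\<forall>S\<subseteq>edges G. card S < k \<longrightarrow> connected_graph (delete_edges G S))"

definition loops_at :: "('v, 'e) pgraph \<Rightarrow> 'v \<Rightarrow> 'e set" where
  "loops_at G v = {e \<in> edges G. ends G e = {#v, v#}}"

end

theory Submission
  imports Defs "HOL-Library.Disjoint_Sets"
begin

text \<open>
  Suppose the edges leaving a vertex set \<open>X\<close> form a small cut. Replace one side at a time by a
  smaller gadget; minimality colours both resulting graphs, and permuting colours on one side glues
  them as soon as they induce the same equality pattern on the cut. For two edges, join their
  ends in \<open>X\<close> directly, so that they get equal colours. For one edge, attach it to a new vertex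
  with two loops. For three edges, a new vertex with one loop forces exactly two of them to
  agree, while joining any two of them and hanging the third on a vertex with two loops makes
  these two agree: either both sides admit a constant pattern, or a side without constant patterns
  realises every pattern with exactly two equal colours. Two bridges are handled through the
  symmetric difference of their sides, which has a boundary of size two.

  A perfect matching gives a colouring, so there is none, and counting edges at a Tutte barrier
  yields a cut of at most three edges. Tutte's theorem is proved by Lovasz's argument with
  an edge-maximal graph without a perfect matching.
\<close>

subsection \<open>Tutte's theorem\<close>

text \<open>A matching is encoded as the involution that swaps partners; on any subset closed under
  it, the same function is again a matching, and values outside \<open>V\<close> are
  arbitrary.\<close>

definition perfect_matching :: "('a \<times> 'a) set \<Rightarrow> 'a set \<Rightarrow> ('a \<Rightarrow> 'a) \<Rightarrow> bool" where
  "perfect_matching Q V f \<longleftrightarrow> (\<forall>x\<in>V. f x \<in> V \<and> f x \<noteq> x \<and> f (f x) = x \<and> (x, f x) \<in> Q)"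

lemma perfect_matching_mono:
  "perfect_matching Q V f \<Longrightarrow> Q \<subseteq> Q' \<Longrightarrow> perfect_matching Q' V f"
  unfolding perfect_matching_def by blast

lemma perfect_matching_Un:
  assumes "perfect_matching Q A f" "perfect_matching Q B g" "A \<inter> B = {}"
  shows "perfect_matching Q (A \<union> B) (\<lambda>x. if x \<in> A then f x else g x)"
  using assms unfolding perfect_matching_def by (auto; blast)

text \<open>The added pair joins only \<open>a\<close> and \<open>c\<close>, so \<open>f\<close>
  makes no use of it on a closed set that avoids both.\<close>

lemma perfect_matching_restrict:
  assumes "perfect_matching (insert (a, c) (insert (c, a) Q)) V f" "W \<subseteq> V"
    and "\<And>y. y \<in> W \<Longrightarrow> f y \<in> W" "a \<notin> W" "c \<notin> W"
  shows "perfect_matching Q W f"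
  using assms unfolding perfect_matching_def by (auto; blast)

lemma perfect_matching_Union:
  assumes "finite I" "\<And>i. i \<in> I \<Longrightarrow> \<exists>f. perfect_matching Q (A i) f"
    and "\<And>i j. i \<in> I \<Longrightarrow> j \<in> I \<Longrightarrow> i \<noteq> j \<Longrightarrow> A i \<inter> A j = {}"
  shows "\<exists>f. perfect_matching Q (\<Union>i\<in>I. A i) f"
  using assms
proof (induction I rule: finite_induct)
  case empty
  then show ?case by (auto simp: perfect_matching_def)
next
  case (insert i I)
  then obtain f where f: "perfect_matching Q (A i) f" by blast
  have "\<exists>f. perfect_matching Q (\<Union>i\<in>I. A i) f"
    by (rule insert.IH) (use insert.prems in auto)
  then obtain g where g: "perfect_matching Q (\<Union>i\<in>I. A i) g" by blast
  have "A i \<inter> A j = {}" if "j \<in> I" for j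
    using insert.prems(2)[of i j] insert.hyps that by auto
  then have "A i \<inter> (\<Union>i\<in>I. A i) = {}" by auto
  from perfect_matching_Un[OF f g this] show ?case by auto
qed

lemma perfect_matching_pair:
  assumes "(x, y) \<in> Q" "sym Q" "x \<noteq> y"
  shows "\<exists>f. perfect_matching Q {x, y} f"
  using assms
  by (intro exI[of _ "\<lambda>z. if z = x then y else x"]) (auto simp: perfect_matching_def dest: symD)

lemma perfect_matching_complete:
  assumes "finite A" "even (card A)" "sym Q"
    and "\<And>x y. x \<in> A \<Longrightarrow> y \<in> A \<Longrightarrow> x \<noteq> y \<Longrightarrow> (x, y) \<in> Q"
  shows "\<exists>f. perfect_matching Q A f"
  using assms
proof (induction "card A" arbitrary: A rule: less_induct)
  case less
  show ?case
  proof (cases "A = {}")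
    case True
    then show ?thesis by (auto simp: perfect_matching_def)
  next
    case False
    then obtain x where x: "x \<in> A" by blast
    have "A \<noteq> {x}" using less.prems(2) by auto
    with x obtain y where y: "y \<in> A" "y \<noteq> x" by blast
    have card: "card A = card (A - {x, y}) + 2"
    proof -
      have "card (A - {x,y}) = card A - card {x,y}"
        by (rule card_Diff_subset) (use x y in auto)
      moreover have "card {x,y} \<le> card A"
        by (rule card_mono) (use x y less.prems(1) in auto)
      ultimately show ?thesis using y by simp
    qed
    have "\<exists>f. perfect_matching Q (A - {x, y}) f"
      by (rule less.hyps) (use card less.prems in auto)
    then obtain f where f: "perfect_matching Q (A - {x, y}) f" by blast
    have "\<exists>f. perfect_matching Q {x, y} f"
      by (rule perfect_matching_pair) (use x y less.prems in auto)
    then obtain g where g: "perfect_matching Q {x, y} g" by blast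
    have "(A - {x, y}) \<union> {x, y} = A" using x y by auto
    then show ?thesis using perfect_matching_Un[OF f g] by auto
  qed
qed

text \<open>
  Follow the alternating walk \<open>d, f d, g (f d), ...\<close> until it meets \<open>a\<close> or \<open>c\<close>, or
  closes up at \<open>b\<close>. In the first case match the walk by \<open>f\<close> and its last vertex with \<open>b\<close>, in the
  second match it by \<open>f\<close>; everything else keeps \<open>g\<close>.
\<close>

lemma perfect_matching_switch:
  fixes Q :: "('a \<times> 'a) set"
  assumes fin: "finite V" and sQ: "sym Q"
    and f: "perfect_matching (insert (a, c) (insert (c, a) Q)) V f" "f a = c"
    and g: "perfect_matching (insert (b, d) (insert (d, b) Q)) V g" "g b = d"
    and V: "a \<in> V" "b \<in> V"
    and Q: "(a, b) \<in> Q" "(b, c) \<in> Q" and ne: "a \<noteq> b" "c \<noteq> b"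
  shows "\<exists>h. perfect_matching Q V h"
proof -
  \<comment> \<open>These are the vertices at even positions of the walk; those at odd positions are
    \<open>f (x i)\<close>.\<close>
  define x where "x i = ((\<lambda>y. g (f y)) ^^ i) d" for i
  have f': "f y \<in> V" "f y \<noteq> y" "f (f y) = y" "y \<in> {a, c} \<or> (y, f y) \<in> Q" if "y \<in> V" for y
    using f that unfolding perfect_matching_def by auto
  have g': "g y \<in> V" "g y \<noteq> y" "g (g y) = y" "y \<in> {b, d} \<or> (y, g y) \<in> Q" if "y \<in> V" for y
    using g that unfolding perfect_matching_def by auto
  have x0: "x 0 = d" and xS: "x (Suc i) = g (f (x i))" for i
    by (simp_all add: x_def)
  have gd: "g d = b" using g'(3)[of b] g V by auto
  have fc: "f c = a" using f'(3)[of a] f V by auto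
  have xV: "x i \<in> V" for i
    by (induction i) (use g'(1)[OF V(2)] g(2) f' g' in \<open>auto simp: x0 xS\<close>)
  have "\<not> inj x"
    using fin xV by (metis finite_subset image_subsetI infinite_iff_countable_subset)
  then obtain i0 j0 where "i0 < j0" "x i0 = x j0"
    by (metis injI linorder_neqE_nat)
  then have ex: "\<exists>j. \<exists>i<j. x i = x j" by blast
  define j where "j = (LEAST j. \<exists>i<j. x i = x j)"
  obtain i where i: "i < j" "x i = x j"
    using LeastI_ex[OF ex] unfolding j_def by blast
  \<comment> \<open>Both involutions can be undone, so a repetition can be moved back by one step on
    both sides; the first repetition must therefore be a return to the start.\<close>
  have "i = 0"
  proof (rule ccontr)
    assume "i \<noteq> 0"
    then obtain i' j' where ij: "i = Suc i'" "j = Suc j'"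
      using i(1) by (metis Suc_lessE not0_implies_Suc)
    have "x i' = x j'"
      using i(2) f' g' xV unfolding ij xS by metis
    then have "\<exists>i<j'. x i = x j'" using i(1) ij by auto
    then have "j \<le> j'" unfolding j_def by (rule Least_le)
    with ij show False by simp
  qed
  with i obtain n where "x (Suc n) = d" using x0 by (metis not0_implies_Suc less_nat_zero_code)
  \<comment> \<open>The vertex before the return to \<open>d\<close> is the \<open>g\<close>-partner
    of \<open>d\<close>, namely \<open>b\<close>, so some stopping condition is met.\<close>
  then have "f (x n) = b" using xS gd g'(3)[OF f'(1)[OF xV]] by metis
  then have ex: "\<exists>k. x k \<in> {a, c} \<or> f (x k) = b" by blast
  define k where "k = (LEAST k. x k \<in> {a, c} \<or> f (x k) = b)"
  have k: "x k \<in> {a, c} \<or> f (x k) = b"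
    using LeastI_ex[OF ex] unfolding k_def by blast
  have less: "x i \<notin> {a, c}" "f (x i) \<noteq> b" if "i < k" for i
    using not_less_Least that unfolding k_def by blast+
  \<comment> \<open>An equality \<open>f (x i) = x j\<close> folds inward to
    \<open>f (x (Suc i)) = x (j - 1)\<close>, until it would give a fixed point of \<open>f\<close>
    or of \<open>g\<close>.\<close>
  have ne_f: "f (x i) \<noteq> x j" if "i \<le> j" for i j
    using that
  proof (induction "j - i" arbitrary: i j rule: less_induct)
    case less
    show ?case
    proof
      assume eq: "f (x i) = x j"
      consider "i = j" | "j = Suc i" | j' where "j = Suc j'" "Suc i \<le> j'"
        using less.prems by (metis le_eq_less_or_eq Suc_le_eq Suc_le_mono old.nat.exhaust not_less0)
      then show False
      proof cases
        case 1
        then show ?thesis using eq f'(2)[OF xV] by simp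
      next
        case 2
        then show ?thesis using eq g'(2)[OF f'(1)[OF xV]] xS by metis
      next
        case 3
        have "x (Suc i) = g (x j)" using eq by (simp add: xS)
        also have "\<dots> = f (x j')" unfolding 3 xS by (rule g'(3)[OF f'(1)[OF xV]])
        finally have "f (x (Suc i)) = x j'" using f'(3)[OF xV] by metis
        then show False using less.hyps[of j' "Suc i"] 3 by auto
      qed
    qed
  qed
  have x_ne_b: "x i \<noteq> b" for i
  proof
    assume b: "x i = b"
    then have "i \<noteq> 0" using x0 g'(2)[OF V(2)] g(2) by metis
    then obtain i' where "i = Suc i'" by (metis not0_implies_Suc)
    then have "f (x i') = x 0"
      using b xS x0 g'(3)[OF f'(1)[OF xV]] g(2) by metis
    then have "f (x 0) = x i'" using f'(3)[OF xV] by metis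
    then show False using ne_f by blast
  qed
  show ?thesis
  proof (cases "x k \<in> {a, c}")
    case False
    \<comment> \<open>The whole closed walk: it is closed under \<open>f\<close> and
      \<open>g\<close>, avoids \<open>a\<close> and \<open>c\<close>, and contains \<open>b\<close>
      and \<open>d\<close>. Hence \<open>f\<close> inside and \<open>g\<close> outside use neither
      added pair.\<close>
    define W where "W = x ` {..k} \<union> (f \<circ> x) ` {..k}"
    have fk: "f (x k) = b" using False k by simp
    have nac: "x i \<notin> {a, c}" if "i \<le> k" for i
      using less(1) False that by (metis le_neq_implies_less)
    have WV: "W \<subseteq> V" unfolding W_def using xV f' by auto
    have Wf: "f y \<in> W" if "y \<in> W" for y
      using that f'(3)[OF xV] unfolding W_def by auto
    have Wg: "g y \<in> W" if "y \<in> W" for y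
    proof -
      have "g (x i) \<in> W" if "i \<le> k" for i
      proof (cases i)
        case 0
        then show ?thesis using x0 gd fk unfolding W_def by force
      next
        case (Suc i')
        then show ?thesis
          using xS[of i'] g'(3)[OF f'(1)[OF xV]] that unfolding W_def by auto
      qed
      moreover have "g (f (x i)) \<in> W" if "i \<le> k" for i
      proof (cases "i = k")
        case True
        then show ?thesis using fk g(2) x0 unfolding W_def by force
      next
        case False
        then have "x (Suc i) \<in> W" using that unfolding W_def by auto
        then show ?thesis by (simp add: xS)
      qed
      ultimately show ?thesis using that unfolding W_def by auto
    qed
    have Wac: "a \<notin> W \<and> c \<notin> W"
    proof -
      have "f (x i) \<notin> {a, c}" if "i \<le> k" for i
        using nac[OF that] f'(3)[OF xV, of i] fc f(2) by auto
      then show ?thesis using nac unfolding W_def by force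
    qed
    have bW: "b \<in> W" "d \<in> W" using fk x0 unfolding W_def by force+
    have "perfect_matching Q W f"
      by (rule perfect_matching_restrict[OF f(1) WV Wf]) (use Wac in auto)
    moreover have "perfect_matching Q (V - W) g"
    proof -
      have "g y \<notin> W" if "y \<in> V - W" for y
        using Wg that g'(3) by (metis DiffE)
      then show ?thesis
        by (intro perfect_matching_restrict[OF g(1)]) (use g' bW in auto)
    qed
    ultimately have "perfect_matching Q (W \<union> (V - W)) (\<lambda>x. if x \<in> W then f x else g x)"
      by (rule perfect_matching_Un) auto
    moreover have "W \<union> (V - W) = V" using WV by auto
    ultimately show ?thesis by metis
  next
    case True
    \<comment> \<open>The walk stopped before \<open>x k\<close>. It becomes closed under
      \<open>g\<close> once \<open>x k\<close> and \<open>b\<close> are added; these two are matched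
      with each other, which \<open>Q\<close> permits as \<open>x k\<close> is \<open>a\<close> or
      \<open>c\<close>.\<close>
    define W where "W = x ` {..<k} \<union> (f \<circ> x) ` {..<k}"
    have WV: "W \<subseteq> V" unfolding W_def using xV f' by auto
    have Wf: "f y \<in> W" if "y \<in> W" for y
      using that f'(3)[OF xV] unfolding W_def by auto
    have Wac: "a \<notin> W \<and> c \<notin> W"
    proof -
      have "f (x i) \<notin> {a, c}" if "i < k" for i
        using less(1)[OF that] f'(3)[OF xV, of i] fc f(2) by auto
      then show ?thesis using less(1) unfolding W_def by force
    qed
    have bW: "b \<notin> W"
      using x_ne_b less(2) unfolding W_def by force
    have Wg: "g y \<in> W \<union> {x k, b}" if "y \<in> W \<union> {x k, b}" for y
    proof -
      have "g (x i) \<in> W \<union> {x k, b}" if "i \<le> k" for i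
      proof (cases i)
        case 0
        then show ?thesis using x0 gd by force
      next
        case (Suc i')
        then show ?thesis
          using xS[of i'] g'(3)[OF f'(1)[OF xV]] that unfolding W_def by auto
      qed
      moreover have "g (f (x i)) \<in> W \<union> {x k, b}" if "i < k" for i
      proof (cases "Suc i = k")
        case True
        then show ?thesis using xS[of i] by auto
      next
        case False
        then have "x (Suc i) \<in> W" using that unfolding W_def by auto
        then show ?thesis by (simp add: xS)
      qed
      moreover have "g b \<in> W \<union> {x k, b}"
        using g(2) x0 unfolding W_def by (cases k) force+
      ultimately have gW: "\<And>i. i < k \<Longrightarrow> g (x i) \<in> W \<union> {x k, b}"
        "\<And>i. i < k \<Longrightarrow> g (f (x i)) \<in> W \<union> {x k, b}"
        and gk: "g (x k) \<in> W \<union> {x k, b}" and gb: "g b \<in> W \<union> {x k, b}"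
        using that by (simp_all only: less_imp_le order_refl)
      have "y \<in> x ` {..<k} \<or> y \<in> (f \<circ> x) ` {..<k} \<or> y = x k \<or> y = b"
        using that unfolding W_def by blast
      then show ?thesis
        using gk gb by (elim disjE imageE) (simp_all only: gW lessThan_iff comp_apply)
    qed
    have mW: "perfect_matching Q W f"
      by (rule perfect_matching_restrict[OF f(1) WV Wf]) (use Wac in auto)
    have kb: "(x k, b) \<in> Q" "x k \<noteq> b"
      using True Q sQ ne by (auto dest: symD)
    obtain p where mp: "perfect_matching Q {x k, b} p"
      using perfect_matching_pair[OF kb(1) sQ kb(2)] by blast
    have dW: "d \<in> W \<union> {x k, b}" using Wg[of b] g(2) by auto
    have mg: "perfect_matching Q (V - (W \<union> {x k, b})) g"
    proof -
      have "g y \<notin> W \<union> {x k, b}" if "y \<in> V - (W \<union> {x k, b})" for y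
        using Wg that g'(3) by (metis DiffE)
      then show ?thesis
        by (intro perfect_matching_restrict[OF g(1)]) (use g' dW in auto)
    qed
    have "W \<inter> {x k, b} = {}" using bW Wac True by auto
    from perfect_matching_Un[OF mW mp this]
    obtain q where mq: "perfect_matching Q (W \<union> {x k, b}) q" by blast
    have "perfect_matching Q ((W \<union> {x k, b}) \<union> (V - (W \<union> {x k, b})))
        (\<lambda>y. if y \<in> W \<union> {x k, b} then q y else g y)"
      by (rule perfect_matching_Un[OF mq mg]) auto
    moreover have "(W \<union> {x k, b}) \<union> (V - (W \<union> {x k, b})) = V"
      using WV xV V by auto
    ultimately show ?thesis by metis
  qed
qed

section \<open>Tutte's theorem from a saturated graph\<close>

lemma even_card_Diff:
  assumes "finite V" "A \<subseteq> V" "even (card A)" "even (card V)"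
  shows "even (card (V - A))"
  using assms by (simp add: card_Diff_subset finite_subset card_mono)

lemma perfect_matching_from_classes:
  assumes fin: "finite V" and ev: "even (card V)" and sQ: "sym Q" and SV: "S \<subseteq> V"
    and S: "\<And>s x. s \<in> S \<Longrightarrow> x \<in> V \<Longrightarrow> x \<noteq> s \<Longrightarrow> (s, x) \<in> Q"
    and P: "partition_on (V - S) P"
    and compl: "\<And>C x y. C \<in> P \<Longrightarrow> x \<in> C \<Longrightarrow> y \<in> C \<Longrightarrow> x \<noteq> y \<Longrightarrow> (x, y) \<in> Q"
    and le: "card {C \<in> P. odd (card C)} \<le> card S"
  shows "\<exists>f. perfect_matching Q V f"
proof -
  have finP: "finite P" using finite_elements[OF _ P] fin by auto
  have finC: "finite C" "C \<subseteq> V - S" "C \<noteq> {}" if "C \<in> P" for C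
    using that partition_onD1[OF P] partition_onD3[OF P] fin
    by (auto intro: finite_subset[of C V])
  have disj: "C \<inter> D = {}" if "C \<in> P" "D \<in> P" "C \<noteq> D" for C D
    using partition_onD2[OF P] that by (auto simp: disjoint_def)
  define Od where "Od = {C \<in> P. odd (card C)}"
  have finS: "finite S" using SV fin finite_subset by blast
  have finOd: "finite Od" using finP unfolding Od_def by auto
  obtain h where h: "inj_on h Od" "h ` Od \<subseteq> S"
    using card_le_inj[OF finOd finS] le unfolding Od_def by blast
  define r where "r C = (SOME x. x \<in> C)" for C :: "'a set"
  have r: "r C \<in> C" if "C \<in> P" for C
    unfolding r_def using finC(3)[OF that] by (meson ex_in_conv someI_ex)
  define B where "B C = (if C \<in> Od then insert (h C) C else C)" for C
  have hS: "h C \<in> S" if "C \<in> Od" for C using h(2) that by auto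
  have mB: "\<exists>f. perfect_matching Q (B C) f" if C: "C \<in> P" for C
  proof (cases "C \<in> Od")
    case True
    have "h C \<noteq> r C" using hS[OF True] r[OF C] finC(2)[OF C] by auto
    moreover have "(h C, r C) \<in> Q"
      using S[OF hS[OF True]] r[OF C] finC(2)[OF C] calculation by auto
    ultimately obtain f where f: "perfect_matching Q {h C, r C} f"
      using perfect_matching_pair[OF _ sQ] by blast
    have "even (card (C - {r C}))"
      using True r[OF C] finC(1)[OF C] by (simp add: Od_def)
    then obtain g where g: "perfect_matching Q (C - {r C}) g"
      using perfect_matching_complete[of "C - {r C}" Q] sQ compl[OF C] finC(1)[OF C] by auto
    have "{h C, r C} \<inter> (C - {r C}) = {}"
      using hS[OF True] finC(2)[OF C] by auto
    from perfect_matching_Un[OF f g this]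
    have "\<exists>f. perfect_matching Q ({h C, r C} \<union> (C - {r C})) f" by blast
    moreover have "{h C, r C} \<union> (C - {r C}) = B C"
      using True r[OF C] by (auto simp: B_def)
    ultimately show ?thesis by simp
  next
    case False
    then show ?thesis
      using perfect_matching_complete[OF finC(1)[OF C] _ sQ compl[OF C]] C
      by (auto simp: B_def Od_def)
  qed
  have disjB: "B C \<inter> B D = {}" if "C \<in> P" "D \<in> P" "C \<noteq> D" for C D
    using disj[OF that] finC(2)[OF that(1)] finC(2)[OF that(2)] hS inj_onD[OF h(1), of C D] that(3)
    unfolding B_def by (auto split: if_splits)
  let ?U = "\<Union>C\<in>P. B C"
  obtain f where f: "perfect_matching Q ?U f"
    using perfect_matching_Union[of P Q B, OF finP mB disjB] by blast
  have UV: "?U \<subseteq> V"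
    using finC(2) hS SV unfolding B_def by (auto split: if_splits)
  have VU: "V - S \<subseteq> ?U"
    using partition_onD1[OF P] unfolding B_def by auto
  have finB: "finite (B C)" if "C \<in> P" for C using finC(1)[OF that] by (simp add: B_def)
  have "card ?U = (\<Sum>C\<in>P. card (B C))"
    by (rule card_UN_disjoint) (use finP finB disjB in auto)
  moreover have "even (card (B C))" if "C \<in> P" for C
  proof (cases "C \<in> Od")
    case True
    then have "h C \<notin> C" using hS[OF True] finC(2)[OF that] by auto
    then show ?thesis using True finC(1)[OF that] by (simp add: B_def Od_def)
  next
    case False
    then show ?thesis using that by (auto simp: B_def Od_def)
  qed
  ultimately have "even (card ?U)" by (simp add: dvd_sum)
  then have "even (card (V - ?U))"
    using even_card_Diff[OF fin UV _ ev] by simp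
  then have "\<exists>g. perfect_matching Q (V - ?U) g"
    by (intro perfect_matching_complete) (use fin sQ S VU in auto)
  then obtain g where g: "perfect_matching Q (V - ?U) g" by blast
  have "?U \<union> (V - ?U) = V" using UV by auto
  then show ?thesis using perfect_matching_Un[OF f g] by (metis Diff_disjoint)
qed

text \<open>The barrier is read off a saturated supergraph \<open>Q\<close> of \<open>R\<close> on
  \<open>V\<close>: \<open>S\<close> consists of the vertices adjacent to all others, and off
  \<open>S\<close> adjacency is transitive, so its classes are cliques. Too few odd classes would
  give \<open>Q\<close> a perfect matching.\<close>

theorem tutte:
  assumes fin: "finite V" and ev: "even (card V)" and R: "sym R"
    and no: "\<nexists>f. perfect_matching R V f"
  obtains S P where "S \<subseteq> V" "partition_on (V - S) P"
    "card S < card {C \<in> P. odd (card C)}"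
    "\<And>C D x y. C \<in> P \<Longrightarrow> D \<in> P \<Longrightarrow> C \<noteq> D \<Longrightarrow> x \<in> C \<Longrightarrow> y \<in> D \<Longrightarrow> (x, y) \<notin> R"
proof -
  let ?R = "R \<inter> V \<times> V"
  \<comment> \<open>Supergraphs are confined to \<open>V \<times> V\<close>, so there are finitely
    many and a maximal one exists.\<close>
  define F where "F = {Q. ?R \<subseteq> Q \<and> Q \<subseteq> V \<times> V \<and> sym Q \<and> (\<nexists>f. perfect_matching Q V f)}"
  have "finite F"
    by (rule finite_subset[of _ "Pow (V \<times> V)"]) (use fin in \<open>auto simp: F_def\<close>)
  moreover have "?R \<in> F"
    using R no perfect_matching_mono[of ?R V _ R] by (auto simp: F_def sym_def)
  ultimately have "\<exists>Q\<in>F. ?R \<subseteq> Q \<and> (\<forall>Q'\<in>F. Q \<subseteq> Q' \<longrightarrow> Q = Q')"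
    by (rule finite_has_maximal2)
  then obtain Q where QF: "Q \<in> F" and max: "\<And>Q'. Q' \<in> F \<Longrightarrow> Q \<subseteq> Q' \<Longrightarrow> Q = Q'"
    by auto
  have RQ: "?R \<subseteq> Q" and QV: "Q \<subseteq> V \<times> V" and sQ: "sym Q"
    and noQ: "\<And>f. \<not> perfect_matching Q V f"
    using QF by (auto simp: F_def)
  \<comment> \<open>By maximality, adding a missing pair creates a perfect matching, which must use
    that pair because \<open>Q\<close> has none.\<close>
  have add: "\<exists>f. perfect_matching (insert (a, b) (insert (b, a) Q)) V f \<and> f a = b"
    if "a \<in> V" "b \<in> V" "(a, b) \<notin> Q" for a b
  proof -
    let ?Q = "insert (a, b) (insert (b, a) Q)"
    have "?Q \<notin> F" using max[of ?Q] that(3) by blast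
    moreover have "?R \<subseteq> ?Q" "?Q \<subseteq> V \<times> V" "sym ?Q"
      using RQ QV sQ that(1,2) by (auto simp: sym_def)
    ultimately obtain f where f: "perfect_matching ?Q V f"
      unfolding F_def by blast
    have "f a = b"
    proof (rule ccontr)
      assume "f a \<noteq> b"
      then have "f b \<noteq> a" using f that(1,2) unfolding perfect_matching_def by metis
      then have "perfect_matching Q V f"
        using f \<open>f a \<noteq> b\<close> unfolding perfect_matching_def by auto
      then show False using noQ by blast
    qed
    with f show ?thesis by blast
  qed
  define S where "S = {s \<in> V. \<forall>x\<in>V. x \<noteq> s \<longrightarrow> (s, x) \<in> Q}"
  define E where "E = {(x, y). x \<in> V - S \<and> y \<in> V - S \<and> (x = y \<or> (x, y) \<in> Q)}"
  \<comment> \<open>Otherwise \<open>b\<close>, lying outside \<open>S\<close>, has a non-neighbour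
    \<open>d\<close>, and the matchings created by the missing pairs \<open>a\<close>,
    \<open>c\<close> and \<open>b\<close>, \<open>d\<close> recombine into one of
    \<open>Q\<close>.\<close>
  have trans: "(a, c) \<in> Q"
    if abc: "a \<in> V" "b \<in> V" "b \<notin> S" "c \<in> V" "(a, b) \<in> Q" "(b, c) \<in> Q" "a \<noteq> b" "c \<noteq> b" for a b c
  proof (rule ccontr)
    assume ac: "(a, c) \<notin> Q"
    obtain d where d: "d \<in> V" "(b, d) \<notin> Q"
      using abc(2,3) unfolding S_def by blast
    obtain f where f: "perfect_matching (insert (a, c) (insert (c, a) Q)) V f" "f a = c"
      using add[OF abc(1,4) ac] by blast
    obtain g where g: "perfect_matching (insert (b, d) (insert (d, b) Q)) V g" "g b = d"
      using add[OF abc(2) d] by blast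
    show False
      using perfect_matching_switch[OF fin sQ f g abc(1,2,5,6,7,8)] noQ by blast
  qed
  have eqv: "equiv (V - S) E"
  proof (rule equivI)
    show "E \<subseteq> (V - S) \<times> (V - S)" by (auto simp: E_def)
    show "refl_on (V - S) E" by (auto simp: refl_on_def E_def)
    show "sym E" using sQ by (auto simp: sym_def E_def)
    show "trans E"
    proof (rule transI)
      fix x y z assume xy: "(x, y) \<in> E" and yz: "(y, z) \<in> E"
      have "x \<in> V - S" "y \<in> V - S" "z \<in> V - S"
        and "x = y \<or> (x, y) \<in> Q" "y = z \<or> (y, z) \<in> Q"
        using xy yz by (auto simp: E_def)
      then show "(x, z) \<in> E"
        using trans[of x y z] by (auto simp: E_def)
    qed
  qed
  define P where "P = (V - S) // E"
  have PE: "(x, y) \<in> E" if "C \<in> P" "x \<in> C" "y \<in> C" for C x y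
    using in_quotient_imp_in_rel[OF eqv, of C x y] that by (simp add: P_def)
  show thesis
  proof
    show "S \<subseteq> V" by (auto simp: S_def)
    show part: "partition_on (V - S) P"
    proof (rule partition_onI)
      show "\<Union>P = V - S" using Union_quotient[OF eqv] by (simp add: P_def)
      show "disjnt C D" if "C \<in> P" "D \<in> P" "C \<noteq> D" for C D
        using quotient_disj[OF eqv] that by (auto simp: P_def disjnt_def)
      show "{} \<notin> P" using in_quotient_imp_non_empty[OF eqv] unfolding P_def by blast
    qed
    show "card S < card {C \<in> P. odd (card C)}"
    proof (rule ccontr)
      assume "\<not> ?thesis"
      then have "\<exists>f. perfect_matching Q V f"
        by (intro perfect_matching_from_classes[OF fin ev sQ _ _ part])
          (use PE in \<open>auto simp: S_def E_def\<close>)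
      then show False using noQ by blast
    qed
    show "(x, y) \<notin> R" if CD: "C \<in> P" "D \<in> P" "C \<noteq> D" "x \<in> C" "y \<in> D" for C D x y
    proof
      assume "(x, y) \<in> R"
      moreover have xy: "x \<in> V - S" "y \<in> V - S"
        using CD partition_onD1[OF part] by auto
      ultimately have "(x, y) \<in> E" using RQ by (auto simp: E_def)
      then have "y \<in> C"
        using in_quotient_imp_closed[OF eqv] CD by (auto simp: P_def)
      moreover have "C \<inter> D = {}" using quotient_disj[OF eqv] CD by (auto simp: P_def)
      ultimately show False using CD by blast
    qed
  qed
qed

subsection \<open>Edge boundaries\<close>

text \<open>Cuts are studied through their sides. As end multisets are unordered, one order of the
  ends suffices, and a loop is never in a boundary.\<close>

definition boundary :: "('v, 'e) pgraph \<Rightarrow> 'v set \<Rightarrow> 'e set" where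
  "boundary G X = {e \<in> edges G. \<exists>u v. ends G e = {#u, v#} \<and> u \<in> X \<and> v \<notin> X}"

definition inner_edges :: "('v, 'e) pgraph \<Rightarrow> 'v set \<Rightarrow> 'e set" where
  "inner_edges G X = {e \<in> edges G. set_mset (ends G e) \<subseteq> X}"

lemma pseudographD:
  assumes "pseudograph G"
  shows "finite (verts G)" "verts G \<noteq> {}" "finite (edges G)"
    and "e \<in> edges G \<Longrightarrow> set_mset (ends G e) \<subseteq> verts G"
    and "e \<in> edges G \<Longrightarrow> \<exists>u v. ends G e = {#u, v#} \<and> u \<in> verts G \<and> v \<in> verts G"
proof -
  show "\<exists>u v. ends G e = {#u, v#} \<and> u \<in> verts G \<and> v \<in> verts G" if "e \<in> edges G"
  proof -
    have "size (ends G e) = 2" "set_mset (ends G e) \<subseteq> verts G"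
      using assms that by (auto simp: pseudograph_def)
    moreover obtain u N where N: "ends G e = add_mset u N"
      using calculation(1) by (cases "ends G e") auto
    moreover obtain v where "N = {#v#}"
      using calculation(1) N size_1_singleton_mset[of N] by auto
    ultimately show ?thesis by auto
  qed
qed (use assms in \<open>auto simp: pseudograph_def\<close>)

lemma boundary_subset: "boundary G X \<subseteq> edges G"
  by (auto simp: boundary_def)

lemma boundary_empty: "boundary G {} = {}"
  by (simp add: boundary_def)

lemma inner_edges_subset: "inner_edges G X \<subseteq> edges G"
  by (auto simp: inner_edges_def)

lemma boundary_iff:
  assumes "e \<in> edges G" "ends G e = {#u, v#}"
  shows "e \<in> boundary G X \<longleftrightarrow> (u \<in> X) \<noteq> (v \<in> X)"
  using assms by (auto simp: boundary_def add_eq_conv_ex)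

lemma inner_edges_iff:
  assumes "e \<in> edges G" "ends G e = {#u, v#}"
  shows "e \<in> inner_edges G X \<longleftrightarrow> u \<in> X \<and> v \<in> X"
  using assms by (auto simp: inner_edges_def)

lemma boundary_compl:
  assumes "pseudograph G"
  shows "boundary G (verts G - X) = boundary G X"
proof -
  have "e \<in> boundary G (verts G - X) \<longleftrightarrow> e \<in> boundary G X" if e: "e \<in> edges G" for e
  proof -
    obtain u v where "ends G e = {#u, v#}" "u \<in> verts G" "v \<in> verts G"
      using pseudographD(5)[OF assms e] by blast
    then show ?thesis using boundary_iff[OF e] by auto
  qed
  then show ?thesis
    using boundary_subset[of G "verts G - X"] boundary_subset[of G X] by blast
qed

lemma boundary_verts:
  assumes "pseudograph G"
  shows "boundary G (verts G) = {}"
proof -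
  have "e \<notin> boundary G (verts G)" if e: "e \<in> edges G" for e
  proof -
    obtain u v where "ends G e = {#u, v#}" "u \<in> verts G" "v \<in> verts G"
      using pseudographD(5)[OF assms e] by blast
    then show ?thesis using boundary_iff[OF e] by auto
  qed
  then show ?thesis using boundary_subset[of G "verts G"] by blast
qed

text \<open>Belonging to the symmetric difference is the sum modulo two of belonging to
  \<open>X\<close> and to \<open>Y\<close>, and whether the two ends of an edge differ adds up in
  the same way. This combines the sides of two bridges, or two single vertices, into one
  set.\<close>

lemma boundary_sym_diff:
  assumes "pseudograph G"
  shows "boundary G (sym_diff X Y) = sym_diff (boundary G X) (boundary G Y)"
proof -
  have "e \<in> boundary G (sym_diff X Y) \<longleftrightarrow> e \<in> sym_diff (boundary G X) (boundary G Y)" if e: "e \<in> edges G" for e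
  proof -
    obtain u v where "ends G e = {#u, v#}" "u \<in> verts G" "v \<in> verts G"
      using pseudographD(5)[OF assms e] by blast
    then show ?thesis using boundary_iff[OF e] by auto
  qed
  then show ?thesis
    using boundary_subset[of G "sym_diff X Y"] boundary_subset[of G X] boundary_subset[of G Y] by blast
qed

lemma boundary_edgeE:
  assumes "pseudograph G" "e \<in> boundary G X" "X \<subseteq> verts G"
  obtains u v where "ends G e = {#u, v#}" "u \<in> X" "v \<in> verts G - X"
  using assms pseudographD(4)[OF assms(1), of e] unfolding boundary_def by force

lemma sum_count_eq_size:
  assumes "finite X"
  shows "(\<Sum>v\<in>X. count M v) = size {#v \<in># M. v \<in> X#}"
proof (induction M)
  case (add x M)
  have "(\<Sum>v\<in>X. count (add_mset x M) v) = (\<Sum>v\<in>X. (if v = x then 1 else 0) + count M v)"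
    by (rule sum.cong) auto
  then show ?case using add assms by (simp add: sum.distrib)
qed simp

text \<open>Double counting of the edge ends in \<open>X\<close>: an inner edge has two, loops
  included, and a boundary edge has one. It also determines the parity of boundaries.\<close>

lemma sum_degree:
  assumes G: "pseudograph G" and X: "X \<subseteq> verts G"
  shows "(\<Sum>v\<in>X. degree G v) = card (boundary G X) + 2 * card (inner_edges G X)"
proof -
  have finX: "finite X" using pseudographD(1)[OF G] X finite_subset by blast
  have finE: "finite (edges G)" by (rule pseudographD(3)[OF G])
  have "(\<Sum>v\<in>X. degree G v) = (\<Sum>e\<in>edges G. \<Sum>v\<in>X. count (ends G e) v)"
    unfolding degree_def by (rule sum.swap)
  also have "\<dots> = (\<Sum>e\<in>edges G. (if e \<in> boundary G X then 1 else 0) + 2 * (if e \<in> inner_edges G X then 1 else 0))"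
  proof (rule sum.cong)
    fix e assume e: "e \<in> edges G"
    obtain u v where uv: "ends G e = {#u, v#}" using pseudographD(5)[OF G e] by blast
    show "(\<Sum>v\<in>X. count (ends G e) v) = (if e \<in> boundary G X then 1 else 0) + 2 * (if e \<in> inner_edges G X then 1 else 0)"
      unfolding sum_count_eq_size[OF finX] boundary_iff[OF e uv] inner_edges_iff[OF e uv] by (simp add: uv)
  qed simp
  also have "\<dots> = card (edges G \<inter> boundary G X) + 2 * card (edges G \<inter> inner_edges G X)"
    using finE by (simp add: sum.distrib sum.If_cases flip: sum_distrib_left)
  finally show ?thesis
    using boundary_subset[of G X] inner_edges_subset[of G X] by (simp add: Int_absorb1)
qed

text \<open>A walk cannot leave a set without boundary; conversely, the set of vertices reachable
  from \<open>u\<close> has no boundary.\<close>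

lemma connected_graph_iff_boundary:
  assumes G: "pseudograph G"
  shows "connected_graph G \<longleftrightarrow> (\<forall>X\<subseteq>verts G. X \<noteq> {} \<longrightarrow> X \<noteq> verts G \<longrightarrow> boundary G X \<noteq> {})"
proof
  assume con: "connected_graph G"
  show "\<forall>X\<subseteq>verts G. X \<noteq> {} \<longrightarrow> X \<noteq> verts G \<longrightarrow> boundary G X \<noteq> {}"
  proof (intro allI impI notI)
    fix X assume X: "X \<subseteq> verts G" "X \<noteq> {}" "X \<noteq> verts G" and c: "boundary G X = {}"
    then obtain u v where uv: "u \<in> X" "v \<in> verts G" "v \<notin> X" by blast
    have "(u, v) \<in> (adjacency G)\<^sup>*"
      using con uv X unfolding connected_graph_def by blast
    then have "v \<in> X"
    proof (induction rule: rtrancl_induct)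
      case (step y z)
      then obtain e where e: "e \<in> edges G" "ends G e = {#y, z#}" by (auto simp: adjacency_def)
      then show ?case using boundary_iff[OF e, of X] c step.IH by simp
    qed (rule uv(1))
    with uv show False by simp
  qed
next
  assume *: "\<forall>X\<subseteq>verts G. X \<noteq> {} \<longrightarrow> X \<noteq> verts G \<longrightarrow> boundary G X \<noteq> {}"
  show "connected_graph G"
    unfolding connected_graph_def
  proof (intro conjI ballI pseudographD(2)[OF G])
    fix u v assume u: "u \<in> verts G" and v: "v \<in> verts G"
    define X where "X = {w \<in> verts G. (u, w) \<in> (adjacency G)\<^sup>*}"
    have "boundary G X = {}"
    proof (rule ccontr)
      assume "boundary G X \<noteq> {}"
      then obtain e where e: "e \<in> boundary G X" by blast
      obtain y z where yz: "ends G e = {#y, z#}" "y \<in> X" "z \<in> verts G - X"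
        by (rule boundary_edgeE[OF G e]) (auto simp: X_def)
      have "(y, z) \<in> adjacency G"
        using yz(1) e boundary_subset by (fastforce simp: adjacency_def)
      then show False using yz by (auto simp: X_def intro: rtrancl_into_rtrancl)
    qed
    moreover have "X \<subseteq> verts G" "u \<in> X" using u by (auto simp: X_def)
    ultimately have "X = verts G" using * by blast
    then show "(u, v) \<in> (adjacency G)\<^sup>*" using v by (auto simp: X_def)
  qed
qed

section \<open>Edge cuts as boundaries of vertex sets\<close>

lemma pseudograph_delete_edges: "pseudograph G \<Longrightarrow> pseudograph (delete_edges G S)"
  by (auto simp: pseudograph_def delete_edges_def)

lemma boundary_delete_edges: "boundary (delete_edges G S) X = boundary G X - S"
  by (auto simp: boundary_def delete_edges_def)

lemma connected_delete_edges_iff: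
  assumes G: "pseudograph G"
  shows "connected_graph (delete_edges G S) \<longleftrightarrow>
    (\<forall>X\<subseteq>verts G. X \<noteq> {} \<longrightarrow> X \<noteq> verts G \<longrightarrow> \<not> boundary G X \<subseteq> S)"
proof -
  have [simp]: "verts (delete_edges G S) = verts G" by (simp add: delete_edges_def)
  show ?thesis
    unfolding connected_graph_iff_boundary[OF pseudograph_delete_edges[OF G]] boundary_delete_edges by simp
qed

text \<open>Deletion of \<open>S\<close> leaves some proper side without boundary, so
  \<open>S\<close> contains the boundary of that side. An edge of \<open>S\<close> outside this
  boundary could be put back without reconnecting the graph, against minimality.\<close>

lemma minimal_edge_cutE:
  assumes G: "pseudograph G" and S: "minimal_edge_cut G S"
  obtains X where "X \<subseteq> verts G" "X \<noteq> {}" "X \<noteq> verts G" "boundary G X = S"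
proof -
  obtain X where X: "X \<subseteq> verts G" "X \<noteq> {}" "X \<noteq> verts G" "boundary G X \<subseteq> S"
    using S connected_delete_edges_iff[OF G, of S]
    unfolding minimal_edge_cut_def edge_cut_def by blast
  have "e \<in> boundary G X" if "e \<in> S" for e
  proof (rule ccontr)
    assume "e \<notin> boundary G X"
    then have "boundary G X \<subseteq> S - {e}" using X by blast
    moreover have "connected_graph (delete_edges G (S - {e}))"
      using S that by (auto simp: minimal_edge_cut_def)
    ultimately show False using connected_delete_edges_iff[OF G] X by blast
  qed
  with X that show thesis by blast
qed

lemma bridgeE:
  assumes G: "pseudograph G" and e: "bridge G e"
  obtains X where "X \<subseteq> verts G" "X \<noteq> {}" "X \<noteq> verts G" "boundary G X = {e}"
proof -
  \<comment> \<open>Minimality holds because putting \<open>e\<close> back restores the connected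
    graph \<open>G\<close>.\<close>
  have "minimal_edge_cut G {e}"
    using e by (auto simp: bridge_def minimal_edge_cut_def edge_cut_def delete_edges_def)
  then show thesis using minimal_edge_cutE[OF G] that by metis
qed

lemma card_loops_at:
  assumes G: "pseudograph G" and v: "v \<in> verts G"
  shows "degree G v = card (boundary G {v}) + 2 * card (loops_at G v)"
proof -
  have "inner_edges G {v} = loops_at G v"
  proof (rule set_eqI)
    fix e
    show "e \<in> inner_edges G {v} \<longleftrightarrow> e \<in> loops_at G v"
    proof (cases "e \<in> edges G")
      case True
      then obtain x y where xy: "ends G e = {#x, y#}" using pseudographD(5)[OF G] by blast
      then show ?thesis
        using inner_edges_iff[OF True xy, of "{v}"] True by (auto simp: loops_at_def add_eq_conv_ex)
    qed (auto simp: inner_edges_def loops_at_def)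
  qed
  then show ?thesis using sum_degree[OF G, of "{v}"] v by simp
qed

subsection \<open>Colourings\<close>

text \<open>The local part of \<open>is_41_coloring\<close>, stated for one vertex so that
  colourings that work only on one side of a cut can be described.\<close>

definition good_at :: "('v, 'e) pgraph \<Rightarrow> ('e \<Rightarrow> 'c) \<Rightarrow> 'v \<Rightarrow> bool" where
  "good_at G c v \<longleftrightarrow> (\<exists>a b. a \<noteq> b \<and> color_degree G c a v = 4 \<and> color_degree G c b v = 1)"

lemma color_degree_altdef:
  "finite (edges G) \<Longrightarrow>
    color_degree G c a v = (\<Sum>e\<in>edges G. if c e = a then count (ends G e) v else 0)"
  unfolding color_degree_def by (rule sum.inter_filter)

text \<open>The colour names \<open>a\<close> and \<open>a'\<close> may differ, which covers
  renamings of colours as well as recolourings away from \<open>v\<close>.\<close>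

lemma color_degree_cong:
  assumes "finite (edges G)"
    and "\<And>e. e \<in> edges G \<Longrightarrow> v \<in># ends G e \<Longrightarrow> c e = a \<longleftrightarrow> c' e = a'"
  shows "color_degree G c a v = color_degree G c' a' v"
  unfolding color_degree_altdef[OF assms(1)]
proof (rule sum.cong[OF refl])
  fix e assume e: "e \<in> edges G"
  show "(if c e = a then count (ends G e) v else 0) = (if c' e = a' then count (ends G e) v else 0)"
    using assms(2)[OF e] by (cases "v \<in># ends G e") (auto simp: not_in_iff)
qed

lemma color_degree_pos_imp_color:
  assumes "color_degree G c a v > 0"
  shows "a \<in> c ` edges G"
proof (rule ccontr)
  assume "a \<notin> c ` edges G"
  then have "{e \<in> edges G. c e = a} = {}" by auto
  with assms show False unfolding color_degree_def by (simp only: sum.empty)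
qed

text \<open>The demand for two colours follows from the local condition at any one vertex, and there
  is one because graphs are nonempty.\<close>

lemma has_41_coloringI:
  fixes c :: "'e \<Rightarrow> nat"
  assumes G: "pseudograph (G :: ('v, 'e) pgraph)" and good: "\<And>v. v \<in> verts G \<Longrightarrow> good_at G c v"
  shows "has_41_coloring G"
proof -
  obtain v where "v \<in> verts G" using pseudographD(2)[OF G] by blast
  then obtain a b where ab: "a \<noteq> b" "color_degree G c a v = 4" "color_degree G c b v = 1"
    using good unfolding good_at_def by blast
  then have "{a, b} \<subseteq> c ` edges G"
    using color_degree_pos_imp_color[of G c _ v] by auto
  then have "card {a, b} \<le> card (c ` edges G)"
    by (intro card_mono) (use pseudographD(3)[OF G] in auto)
  then have "is_41_coloring G c"
    using ab good by (auto simp: is_41_coloring_def good_at_def)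
  then show ?thesis by (auto simp: has_41_coloring_def)
qed

text \<open>Give the edges of \<open>M\<close> one colour and all others another: every vertex has
  one edge end in the first class and the remaining four in the second.\<close>

lemma has_41_coloring_if_matching:
  assumes G: "pseudograph G" and reg: "regular 5 G" and M: "M \<subseteq> edges G"
    and one: "\<And>v. v \<in> verts G \<Longrightarrow> (\<Sum>e\<in>M. count (ends G e) v) = 1"
  shows "has_41_coloring G"
proof (rule has_41_coloringI[OF G])
  fix v assume v: "v \<in> verts G"
  let ?c = "\<lambda>e. if e \<in> M then 1 else 0 :: nat"
  have "{e \<in> edges G. ?c e = 1} = M" "{e \<in> edges G. ?c e = 0} = edges G - M"
    using M by auto
  moreover have "(\<Sum>e\<in>edges G - M. count (ends G e) v) = 4"
    using sum.subset_diff[OF M pseudographD(3)[OF G], of "\<lambda>e. count (ends G e) v"] one[OF v] reg v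
    by (simp add: regular_def degree_def)
  ultimately have "color_degree G ?c 0 v = 4" "color_degree G ?c 1 v = 1"
    using one[OF v] by (simp_all add: color_degree_def)
  then show "good_at G ?c v" unfolding good_at_def by (metis zero_neq_one)
qed

text \<open>Only equality of colours matters, so the colours of \<open>c2\<close> can be renamed
  injectively to coincide with \<open>c1\<close> on the boundary as soon as both have the same
  equality pattern there.\<close>

lemma has_41_coloring_glue:
  fixes c1 c2 :: "'e \<Rightarrow> nat"
  assumes G: "pseudograph (G :: ('v, 'e) pgraph)"
    and c1: "\<And>v. v \<in> X \<Longrightarrow> good_at G c1 v"
    and c2: "\<And>v. v \<in> verts G - X \<Longrightarrow> good_at G c2 v"
    and agree: "\<And>e f. e \<in> boundary G X \<Longrightarrow> f \<in> boundary G X \<Longrightarrow> c1 e = c1 f \<longleftrightarrow> c2 e = c2 f"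
  shows "has_41_coloring G"
proof (rule has_41_coloringI[OF G])
  let ?B = "boundary G X"
  have fin: "finite (edges G)" by (rule pseudographD(3)[OF G])
  \<comment> \<open>The colours of \<open>c1\<close> are doubled. A colour that \<open>c2\<close>
    uses on the boundary takes the even code of its \<open>c1\<close> counterpart; every other one
    takes an odd code, so no clash arises.\<close>
  define r where "r k = (if k \<in> c2 ` ?B then 2 * c1 (inv_into ?B c2 k) else 2 * k + 1)" for k
  have r: "r (c2 f) = 2 * c1 f" if "f \<in> ?B" for f
    using agree[of "inv_into ?B c2 (c2 f)" f] that
    by (auto simp: r_def inv_into_into f_inv_into_f)
  have inj: "r k = r l \<longleftrightarrow> k = l" for k l
  proof
    assume eq: "r k = r l"
    show "k = l"
    proof (cases "k \<in> c2 ` ?B \<and> l \<in> c2 ` ?B")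
      case True
      then obtain e f where "e \<in> ?B" "f \<in> ?B" "k = c2 e" "l = c2 f" by blast
      then show ?thesis using eq r agree[of e f] by simp
    next
      case False
      then show ?thesis using eq by (auto simp: r_def split: if_splits; presburger)
    qed
  qed simp
  \<comment> \<open>Boundary edges fall under the first case, but \<open>r\<close> makes both cases
    agree on them.\<close>
  define c where "c e = (if set_mset (ends G e) \<inter> X \<noteq> {} then 2 * c1 e else r (c2 e))" for e
  show "good_at G c v" if v: "v \<in> verts G" for v
  proof (cases "v \<in> X")
    case True
    have "color_degree G c (2 * a) v = color_degree G c1 a v" for a
      by (rule color_degree_cong[OF fin]) (use True in \<open>auto simp: c_def\<close>)
    then show ?thesis
      using c1[OF True] unfolding good_at_def by (metis mult_cancel1 zero_neq_numeral)
  next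
    case False
    have "c e = r (c2 e)" if e: "e \<in> edges G" "v \<in># ends G e" for e
    proof -
      obtain x y where xy: "ends G e = {#x, y#}" using pseudographD(5)[OF G e(1)] by blast
      then have "set_mset (ends G e) \<inter> X \<noteq> {} \<Longrightarrow> e \<in> ?B"
        using e False by (auto simp: boundary_iff[OF e(1) xy])
      then show ?thesis using r by (auto simp: c_def)
    qed
    then have "color_degree G c (r a) v = color_degree G c2 a v" for a
      by (intro color_degree_cong[OF fin]) (use inj in auto)
    then show ?thesis
      using c2[of v] False v inj unfolding good_at_def by (metis DiffI)
  qed
qed

text \<open>Minimality is assumed only for graphs on natural numbers, whereas the gadget graphs live
  on other types. A finite graph is copied along injections into the naturals and the colouring is
  pulled back.\<close>

lemma has_41_coloring_transfer:
  fixes H :: "('a, 'b) pgraph"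
  assumes H: "pseudograph H" "regular 5 H"
    and small: "\<And>K :: (nat, nat) pgraph. pseudograph K \<Longrightarrow> regular 5 K \<Longrightarrow>
      card (verts K) = card (verts H) \<Longrightarrow> has_41_coloring K"
  shows "has_41_coloring H"
proof -
  obtain p :: "'a \<Rightarrow> nat" where p: "inj_on p (verts H)"
    using finite_imp_inj_to_nat_seg[OF pseudographD(1)[OF H(1)]] by blast
  obtain q :: "'b \<Rightarrow> nat" where q: "inj_on q (edges H)"
    using finite_imp_inj_to_nat_seg[OF pseudographD(3)[OF H(1)]] by blast
  define K where "K = \<lparr>verts = p ` verts H, edges = q ` edges H,
    ends = (\<lambda>i. image_mset p (ends H (inv_into (edges H) q i)))\<rparr>"
  have ends: "ends K (q e) = image_mset p (ends H e)" if "e \<in> edges H" for e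
    using that q by (simp add: K_def)
  have cnt: "count (ends K (q e)) (p v) = count (ends H e) v"
    if e: "e \<in> edges H" and v: "v \<in> verts H" for e v
  proof -
    obtain x y where "ends H e = {#x, y#}" "x \<in> verts H" "y \<in> verts H"
      using pseudographD(5)[OF H(1) e] by blast
    then show ?thesis using inj_onD[OF p] v by (auto simp: ends[OF e])
  qed
  have cd: "color_degree K c a (p v) = color_degree H (c \<circ> q) a v" if "v \<in> verts H"
    for c :: "nat \<Rightarrow> 'c" and a v
  proof -
    have "{i \<in> edges K. c i = a} = q ` {e \<in> edges H. (c \<circ> q) e = a}"
      by (auto simp: K_def)
    moreover have "inj_on q {e \<in> edges H. (c \<circ> q) e = a}"
      by (rule inj_on_subset[OF q]) auto
    ultimately show ?thesis
      using that by (auto simp: color_degree_def sum.reindex cnt intro!: sum.cong)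
  qed
  \<comment> \<open>The degree is the colour degree of a constant colouring.\<close>
  have deg: "degree K (p v) = degree H v" if "v \<in> verts H" for v
    using cd[OF that, of "\<lambda>_. ()" "()"] by (simp add: color_degree_def degree_def)
  have "has_41_coloring K"
  proof (rule small)
    show "pseudograph K"
    proof -
      have "size (ends K (q e)) = 2 \<and> set_mset (ends K (q e)) \<subseteq> verts K" if "e \<in> edges H" for e
        using H(1) that unfolding ends[OF that] pseudograph_def by (auto simp: K_def)
      then show ?thesis
        using H(1) unfolding pseudograph_def by (auto simp: K_def)
    qed
    show "regular 5 K" using H(2) deg by (auto simp: regular_def K_def)
    show "card (verts K) = card (verts H)" using p by (simp add: K_def card_image)
  qed
  then obtain c :: "nat \<Rightarrow> nat" where "is_41_coloring K c" by (auto simp: has_41_coloring_def)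
  then have "good_at H (c \<circ> q) v" if "v \<in> verts H" for v
    using that by (auto simp: good_at_def is_41_coloring_def K_def cd[unfolded K_def])
  then show ?thesis by (rule has_41_coloringI[OF H(1)])
qed

lemma has_41_coloring_if_perfect_matching:
  assumes G: "pseudograph G" and reg: "regular 5 G"
    and f: "perfect_matching (adjacency G) (verts G) f"
  shows "has_41_coloring G"
proof -
  define p where "p v = {#v, f v#}" for v
  \<comment> \<open>The edge is chosen for the unordered pair, so that \<open>v\<close> and
    \<open>f v\<close> select the same one among parallel edges.\<close>
  define s where "s M = (SOME e. e \<in> edges G \<and> ends G e = M)" for M
  have f': "f v \<in> verts G" "f v \<noteq> v" "f (f v) = v" if "v \<in> verts G" for v
    using f that by (auto simp: perfect_matching_def)
  have s: "s (p v) \<in> edges G" "ends G (s (p v)) = p v" if v: "v \<in> verts G" for v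
  proof -
    have "\<exists>e. e \<in> edges G \<and> ends G e = p v"
      using f v by (auto simp: perfect_matching_def adjacency_def p_def)
    from someI_ex[OF this] show "s (p v) \<in> edges G" "ends G (s (p v)) = p v"
      by (auto simp: s_def)
  qed
  have p_f: "p (f v) = p v" if "v \<in> verts G" for v
    using f'(3)[OF that] by (simp add: p_def add_mset_commute)
  let ?M = "(\<lambda>v. s (p v)) ` verts G"
  show ?thesis
  proof (rule has_41_coloring_if_matching[OF G reg, of ?M])
    show "?M \<subseteq> edges G" using s by auto
  next
    fix v assume v: "v \<in> verts G"
    have "(\<Sum>e\<in>?M. count (ends G e) v) = (\<Sum>e\<in>{s (p v)}. count (ends G e) v)"
    proof (rule sum.mono_neutral_right)
      show "finite ?M" using pseudographD(1)[OF G] by simp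
      show "{s (p v)} \<subseteq> ?M" using v by auto
      show "\<forall>e\<in>?M - {s (p v)}. count (ends G e) v = 0"
      proof (rule ballI, rule ccontr)
        fix e assume e: "e \<in> ?M - {s (p v)}" "count (ends G e) v \<noteq> 0"
        then obtain w where w: "w \<in> verts G" "e = s (p w)" by auto
        then have "v = w \<or> v = f w" using e s[OF w(1)] by (auto simp: p_def split: if_splits)
        then have "p v = p w" using p_f[OF w(1)] by auto
        then show False using e(1) w(2) by simp
      qed
    qed
    also have "\<dots> = 1" using s(2)[OF v] f'(2)[OF v] by (simp add: p_def)
    finally show "(\<Sum>e\<in>?M. count (ends G e) v) = 1" .
  qed
qed

lemma sym_adjacency: "sym (adjacency G)"
  by (auto simp: sym_def adjacency_def add_mset_commute)

subsection \<open>Minimal counterexamples\<close>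

locale minimal_counterexample =
  fixes G :: "('v, 'e) pgraph"
  assumes pseudo: "pseudograph G"
    and reg: "regular 5 G"
    and no_coloring: "\<not> has_41_coloring G"
    and minimal: "\<And>H :: (nat, nat) pgraph.
      pseudograph H \<Longrightarrow> regular 5 H \<Longrightarrow> card (verts H) < card (verts G) \<Longrightarrow> has_41_coloring H"
begin

section \<open>Replacing one side of a cut by a gadget\<close>

lemma edge_sum_split:
  assumes v: "v \<in> X"
  shows "(\<Sum>e\<in>edges G. if P e then count (ends G e) v else 0) =
    (\<Sum>e\<in>inner_edges G X. if P e then count (ends G e) v else 0) +
    (\<Sum>e\<in>boundary G X. if P e then count (ends G e) v else 0)"
proof -
  let ?f = "\<lambda>e. if P e then count (ends G e) v else 0"
  have "sum ?f (edges G) = sum ?f (inner_edges G X \<union> boundary G X)"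
  proof (rule sum.mono_neutral_right[OF pseudographD(3)[OF pseudo]])
    show "\<forall>e\<in>edges G - (inner_edges G X \<union> boundary G X). ?f e = 0"
    proof
      fix e assume e: "e \<in> edges G - (inner_edges G X \<union> boundary G X)"
      then obtain x y where xy: "ends G e = {#x, y#}" using pseudographD(5)[OF pseudo] by blast
      then have "x \<notin> X" "y \<notin> X"
        using e boundary_iff[OF _ xy, of X] inner_edges_iff[OF _ xy, of X] by auto
      then show "?f e = 0" using v xy by auto
    qed
  qed (use boundary_subset[of G X] inner_edges_subset[of G X] in auto)
  also have "\<dots> = sum ?f (inner_edges G X) + sum ?f (boundary G X)"
    by (rule sum.union_disjoint)
      (use boundary_subset[of G X] inner_edges_subset[of G X] pseudographD(3)[OF pseudo] in
        \<open>auto simp: boundary_def inner_edges_def intro: finite_subset\<close>)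
  finally show ?thesis .
qed

text \<open>
  The part of the graph outside \<open>X\<close> is replaced by the vertices of \<open>Y - X\<close>, and the edges
  not inside \<open>X\<close> by those listed in \<open>L\<close>. By minimality the result has a colouring; \<open>c\<close> is its
  restriction to the edges inside \<open>X\<close> and \<open>l i\<close> the colour of the \<open>i\<close>-th new edge.
\<close>

lemma gadget_coloring:
  assumes X: "X \<subseteq> Y" "Y \<subset> verts G" "Y \<noteq> {}"
    and L: "\<And>M. M \<in> set L \<Longrightarrow> size M = 2 \<and> set_mset M \<subseteq> Y"
    and degX: "\<And>v. v \<in> X \<Longrightarrow>
      (\<Sum>i<length L. count (L ! i) v) = (\<Sum>e\<in>boundary G X. count (ends G e) v)"
    and degY: "\<And>v. v \<in> Y - X \<Longrightarrow> (\<Sum>i<length L. count (L ! i) v) = 5"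
  obtains c :: "'e \<Rightarrow> nat" and l :: "nat \<Rightarrow> nat" where
    "\<And>c' v. v \<in> X \<Longrightarrow> (\<And>e. e \<in> inner_edges G X \<Longrightarrow> c' e = c e) \<Longrightarrow>
      (\<And>a. (\<Sum>e\<in>boundary G X. if c' e = a then count (ends G e) v else 0) =
        (\<Sum>i<length L. if l i = a then count (L ! i) v else 0)) \<Longrightarrow> good_at G c' v"
    "\<And>v. v \<in> Y - X \<Longrightarrow> \<exists>a b. a \<noteq> b \<and>
      (\<Sum>i<length L. if l i = a then count (L ! i) v else 0) = 4 \<and>
      (\<Sum>i<length L. if l i = b then count (L ! i) v else 0) = 1"
proof -
  let ?I = "inner_edges G X"
  \<comment> \<open>New edges are named by their positions in \<open>L\<close>, so equal entries
    remain distinct parallel edges or loops.\<close>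
  define H where "H = \<lparr>verts = Y, edges = Inl ` ?I \<union> Inr ` {..<length L},
    ends = case_sum (ends G) (\<lambda>i. L ! i)\<rparr>"
  have finI: "finite ?I"
    using inner_edges_subset pseudographD(3)[OF pseudo] by (rule finite_subset)
  have finY: "finite Y"
    using X(2) pseudographD(1)[OF pseudo] by (auto intro: finite_subset)
  have "\<forall>i<length L. size (L ! i) = 2 \<and> set_mset (L ! i) \<subseteq> Y"
    using L by simp
  moreover have "\<forall>e\<in>?I. size (ends G e) = 2 \<and> set_mset (ends G e) \<subseteq> Y"
    using pseudo X(1) by (auto simp: pseudograph_def inner_edges_def)
  ultimately have H: "pseudograph H"
    using finI finY X(3) unfolding pseudograph_def by (simp add: H_def ball_Un)
  have split: "(\<Sum>e\<in>edges H. if P e then count (ends H e) v else 0) =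
      (\<Sum>e\<in>?I. if P (Inl e) then count (ends G e) v else 0) +
      (\<Sum>i<length L. if P (Inr i) then count (L ! i) v else 0)" for P v
  proof -
    let ?f = "\<lambda>e. if P e then count (ends H e) v else 0"
    have "sum ?f (edges H) = sum ?f (Inl ` ?I) + sum ?f (Inr ` {..<length L})"
      unfolding H_def by (simp, rule sum.union_disjoint) (use finI in auto)
    then show ?thesis by (simp add: sum.reindex H_def cong: if_cong)
  qed
  have inner0: "(\<Sum>e\<in>?I. if P e then count (ends G e) v else 0) = 0" if "v \<notin> X" for P v
  proof (rule sum.neutral, rule ballI)
    fix e assume "e \<in> ?I"
    then have "v \<notin># ends G e" using that by (auto simp: inner_edges_def)
    then show "(if P e then count (ends G e) v else 0) = 0" by (simp add: not_in_iff)
  qed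
  have "degree H v = 5" if v: "v \<in> Y" for v
  proof (cases "v \<in> X")
    case True
    have "degree H v = degree G v"
      using split[of "\<lambda>_. True" v] edge_sum_split[OF True, of "\<lambda>_. True"] degX[OF True]
      by (simp add: degree_def)
    then show ?thesis using reg v X by (auto simp: regular_def)
  next
    case False
    then show ?thesis
      using split[of "\<lambda>_. True" v] inner0[OF False, of "\<lambda>_. True"] degY[of v] v
      by (simp add: degree_def)
  qed
  then have "regular 5 H" by (simp add: regular_def H_def)
  moreover have "card (verts H) < card (verts G)"
    using psubset_card_mono[OF pseudographD(1)[OF pseudo] X(2)] by (simp add: H_def)
  ultimately have "has_41_coloring H"
    using has_41_coloring_transfer[OF H] minimal by simp
  then obtain k :: "'e + nat \<Rightarrow> nat" where k: "\<And>v. v \<in> Y \<Longrightarrow> good_at H k v"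
    by (auto simp: has_41_coloring_def is_41_coloring_def good_at_def H_def)
  have finH: "finite (edges H)" by (rule pseudographD(3)[OF H])
  have cd: "color_degree H k a v = (\<Sum>e\<in>?I. if k (Inl e) = a then count (ends G e) v else 0) +
      (\<Sum>i<length L. if k (Inr i) = a then count (L ! i) v else 0)" for a v
    unfolding color_degree_altdef[OF finH] by (rule split)
  show thesis
  proof (rule that[of "\<lambda>e. k (Inl e)" "\<lambda>i. k (Inr i)"])
    fix c' v
    assume v: "v \<in> X" and c': "\<And>e. e \<in> ?I \<Longrightarrow> c' e = k (Inl e)"
      and eq: "\<And>a. (\<Sum>e\<in>boundary G X. if c' e = a then count (ends G e) v else 0) =
        (\<Sum>i<length L. if k (Inr i) = a then count (L ! i) v else 0)"
    have "color_degree G c' a v = color_degree H k a v" for a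
      unfolding cd color_degree_altdef[OF pseudographD(3)[OF pseudo]]
        edge_sum_split[OF v] eq using c' by simp
    then show "good_at G c' v" using k[of v] v X by (auto simp: good_at_def)
  next
    fix v assume v: "v \<in> Y - X"
    then show "\<exists>a b. a \<noteq> b \<and>
      (\<Sum>i<length L. if k (Inr i) = a then count (L ! i) v else 0) = 4 \<and>
      (\<Sum>i<length L. if k (Inr i) = b then count (L ! i) v else 0) = 1"
      using k[of v] inner0[of v] unfolding good_at_def cd by simp
  qed
qed

lemma boundary_not_inner: "e \<in> boundary G X \<Longrightarrow> e \<notin> inner_edges G X"
  by (auto simp: boundary_def inner_edges_def)

lemma extension_0:
  assumes X: "X \<subseteq> verts G" "X \<noteq> {}" "X \<noteq> verts G" and B: "boundary G X = {}"
  obtains c :: "'e \<Rightarrow> nat" where "\<And>v. v \<in> X \<Longrightarrow> good_at G c v"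
proof -
  obtain c :: "'e \<Rightarrow> nat" and l :: "nat \<Rightarrow> nat" where
    c: "\<And>c' v. v \<in> X \<Longrightarrow> (\<And>e. e \<in> inner_edges G X \<Longrightarrow> c' e = c e) \<Longrightarrow>
      (\<And>a. (\<Sum>e\<in>boundary G X. if c' e = a then count (ends G e) v else 0) =
        (\<Sum>i<length ([] :: 'v multiset list). if l i = a then count ([] ! i) v else 0)) \<Longrightarrow> good_at G c' v"
    by (rule gadget_coloring[of X X "[]"]) (use X B in auto)
  show thesis by (rule that[of c], rule c) (use B in auto)
qed

text \<open>One edge to \<open>X\<close> and two loops give the new vertex degree five. The name
  \<open>z\<close> is borrowed from the other side, whose second vertex makes the gadget graph
  smaller than \<open>G\<close>.\<close>

lemma extension_1:
  assumes X: "X \<subseteq> verts G" "card (verts G - X) \<ge> 2" and B: "boundary G X = {e}"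
  obtains c :: "'e \<Rightarrow> nat" where "\<And>v. v \<in> X \<Longrightarrow> good_at G c v"
proof -
  obtain z where z: "z \<in> verts G - X"
    using X(2) by (metis card.empty ex_in_conv not_numeral_le_zero)
  have Y: "insert z X \<subset> verts G"
  proof -
    have "verts G - X \<noteq> {z}" using X(2) by auto
    then show ?thesis using z X(1) by blast
  qed
  obtain x y where e: "ends G e = {#x, y#}" "x \<in> X" "y \<in> verts G - X"
    using boundary_edgeE[OF pseudo _ X(1), of e] B by blast
  let ?L = "[{#x, z#}, {#z, z#}, {#z, z#}]"
  obtain c :: "'e \<Rightarrow> nat" and l :: "nat \<Rightarrow> nat" where
    c: "\<And>c' v. v \<in> X \<Longrightarrow> (\<And>e. e \<in> inner_edges G X \<Longrightarrow> c' e = c e) \<Longrightarrow>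
      (\<And>a. (\<Sum>e\<in>boundary G X. if c' e = a then count (ends G e) v else 0) =
        (\<Sum>i<length ?L. if l i = a then count (?L ! i) v else 0)) \<Longrightarrow> good_at G c' v"
    by (rule gadget_coloring[of X "insert z X" ?L]) (use Y z e B in auto)
  \<comment> \<open>The cut edge inherits the colour of the new edge that took its place at
    \<open>x\<close>.\<close>
  have "good_at G (c(e := l 0)) v" if "v \<in> X" for v
    by (rule c[OF that]) (use that B z e boundary_not_inner[of e X] in auto)
  then show thesis by (rule that)
qed

text \<open>One new edge replaces both cut edges, so they get the same colour; if both have the same
  end in \<open>X\<close>, the new edge is a loop and still accounts for two ends.\<close>

lemma extension_2:
  assumes X: "X \<subseteq> verts G" "X \<noteq> verts G" and B: "boundary G X = {e, f}" "e \<noteq> f"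
  obtains c :: "'e \<Rightarrow> nat" where "\<And>v. v \<in> X \<Longrightarrow> good_at G c v" "c e = c f"
proof -
  obtain x y where e: "ends G e = {#x, y#}" "x \<in> X" "y \<in> verts G - X"
    using boundary_edgeE[OF pseudo _ X(1), of e] B by blast
  obtain x' y' where f: "ends G f = {#x', y'#}" "x' \<in> X" "y' \<in> verts G - X"
    using boundary_edgeE[OF pseudo _ X(1), of f] B by blast
  let ?L = "[{#x, x'#}]"
  obtain c :: "'e \<Rightarrow> nat" and l :: "nat \<Rightarrow> nat" where
    c: "\<And>c' v. v \<in> X \<Longrightarrow> (\<And>e. e \<in> inner_edges G X \<Longrightarrow> c' e = c e) \<Longrightarrow>
      (\<And>a. (\<Sum>e\<in>boundary G X. if c' e = a then count (ends G e) v else 0) =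
        (\<Sum>i<length ?L. if l i = a then count (?L ! i) v else 0)) \<Longrightarrow> good_at G c' v"
    by (rule gadget_coloring[of X X ?L]) (use X e f B in auto)
  have "good_at G (c(e := l 0, f := l 0)) v" if "v \<in> X" for v
    by (rule c[OF that]) (use that B e f boundary_not_inner[of _ X] in auto)
  then show thesis by (rule that) (use B(2) in auto)
qed

text \<open>The first colouring comes from joining the ends of \<open>e\<close> and \<open>f\<close>
  and hanging \<open>g\<close> on a vertex with two loops, the second from hanging all three on a
  vertex with one loop.\<close>

lemma extension_3:
  assumes X: "X \<subseteq> verts G" "card (verts G - X) \<ge> 2"
    and B: "boundary G X = {e, f, g}" "e \<noteq> f" "e \<noteq> g" "f \<noteq> g"
  shows "\<exists>c :: 'e \<Rightarrow> nat. (\<forall>v\<in>X. good_at G c v) \<and> c e = c f"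
    and "\<exists>c :: 'e \<Rightarrow> nat. (\<forall>v\<in>X. good_at G c v) \<and>
      (c e = c f \<and> c e \<noteq> c g \<or> c e = c g \<and> c e \<noteq> c f \<or> c f = c g \<and> c e \<noteq> c f)"
proof -
  obtain z where z: "z \<in> verts G - X"
    using X(2) by (metis card.empty ex_in_conv not_numeral_le_zero)
  have Y: "insert z X \<subset> verts G"
  proof -
    have "verts G - X \<noteq> {z}" using X(2) by auto
    then show ?thesis using z X(1) by blast
  qed
  obtain x1 y1 where e: "ends G e = {#x1, y1#}" "x1 \<in> X" "y1 \<in> verts G - X"
    using boundary_edgeE[OF pseudo _ X(1), of e] B by blast
  obtain x2 y2 where f: "ends G f = {#x2, y2#}" "x2 \<in> X" "y2 \<in> verts G - X"
    using boundary_edgeE[OF pseudo _ X(1), of f] B by blast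
  obtain x3 y3 where g: "ends G g = {#x3, y3#}" "x3 \<in> X" "y3 \<in> verts G - X"
    using boundary_edgeE[OF pseudo _ X(1), of g] B by blast
  have ni: "e \<notin> inner_edges G X" "f \<notin> inner_edges G X" "g \<notin> inner_edges G X"
    using B(1) boundary_not_inner[of _ X] by auto
  let ?L = "[{#x1, x2#}, {#x3, z#}, {#z, z#}, {#z, z#}]"
  obtain c :: "'e \<Rightarrow> nat" and l :: "nat \<Rightarrow> nat" where
    c: "\<And>c' v. v \<in> X \<Longrightarrow> (\<And>e. e \<in> inner_edges G X \<Longrightarrow> c' e = c e) \<Longrightarrow>
      (\<And>a. (\<Sum>e\<in>boundary G X. if c' e = a then count (ends G e) v else 0) =
        (\<Sum>i<length ?L. if l i = a then count (?L ! i) v else 0)) \<Longrightarrow> good_at G c' v"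
    by (rule gadget_coloring[of X "insert z X" ?L]) (use Y z e f g B in auto)
  have "good_at G (c(e := l 0, f := l 0, g := l 1)) v" if "v \<in> X" for v
    by (rule c[OF that]) (use that B z e f g ni in auto)
  then show "\<exists>c :: 'e \<Rightarrow> nat. (\<forall>v\<in>X. good_at G c v) \<and> c e = c f"
    using B by (intro exI[of _ "c(e := l 0, f := l 0, g := l 1)"]) auto
  let ?L = "[{#x1, z#}, {#x2, z#}, {#x3, z#}, {#z, z#}]"
  obtain c :: "'e \<Rightarrow> nat" and l :: "nat \<Rightarrow> nat" where
    c: "\<And>c' v. v \<in> X \<Longrightarrow> (\<And>e. e \<in> inner_edges G X \<Longrightarrow> c' e = c e) \<Longrightarrow>
      (\<And>a. (\<Sum>e\<in>boundary G X. if c' e = a then count (ends G e) v else 0) =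
        (\<Sum>i<length ?L. if l i = a then count (?L ! i) v else 0)) \<Longrightarrow> good_at G c' v"
    and z_good: "\<And>v. v \<in> insert z X - X \<Longrightarrow> \<exists>a b. a \<noteq> b \<and>
      (\<Sum>i<length ?L. if l i = a then count (?L ! i) v else 0) = 4 \<and>
      (\<Sum>i<length ?L. if l i = b then count (?L ! i) v else 0) = 1"
    by (rule gadget_coloring[of X "insert z X" ?L]) (use Y z e f g B in auto)
  have "good_at G (c(e := l 0, f := l 1, g := l 2)) v" if "v \<in> X" for v
    by (rule c[OF that]) (use that B z e f g ni in \<open>auto simp: numeral_2_eq_2\<close>)
  \<comment> \<open>The loop at \<open>z\<close> contributes two to its colour, hence has the colour
    of degree four, together with exactly two of the three other edges.\<close>
  moreover have "l 0 = l 1 \<and> l 0 \<noteq> l 2 \<or> l 0 = l 2 \<and> l 0 \<noteq> l 1 \<or> l 1 = l 2 \<and> l 0 \<noteq> l 1"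
  proof -
    have "x1 \<noteq> z" "x2 \<noteq> z" "x3 \<noteq> z" using z e f g by auto
    then show ?thesis
      using z_good[of z] z by (auto simp: numeral_2_eq_2 split: if_splits)
  qed
  ultimately show "\<exists>c :: 'e \<Rightarrow> nat. (\<forall>v\<in>X. good_at G c v) \<and>
      (c e = c f \<and> c e \<noteq> c g \<or> c e = c g \<and> c e \<noteq> c f \<or> c f = c g \<and> c e \<noteq> c f)"
    using B by (intro exI[of _ "c(e := l 0, f := l 1, g := l 2)"]) auto
qed

section \<open>Boundaries with at most three edges\<close>

lemma boundary_nonempty:
  assumes X: "X \<subseteq> verts G" "X \<noteq> {}" "X \<noteq> verts G"
  shows "boundary G X \<noteq> {}"
proof
  assume B: "boundary G X = {}"
  obtain c1 :: "'e \<Rightarrow> nat" where "\<And>v. v \<in> X \<Longrightarrow> good_at G c1 v"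
    using extension_0[OF X B] by blast
  moreover obtain c2 :: "'e \<Rightarrow> nat" where "\<And>v. v \<in> verts G - X \<Longrightarrow> good_at G c2 v"
    by (rule extension_0[of "verts G - X"]) (use X B boundary_compl[OF pseudo, of X] in auto)
  ultimately show False
    using has_41_coloring_glue[OF pseudo, of X c1 c2] B no_coloring by simp
qed

lemma connected: "connected_graph G"
  using boundary_nonempty by (simp add: connected_graph_iff_boundary[OF pseudo])

text \<open>Each side can be coloured with equal colours on the two boundary edges, so the sides
  would glue. Any vertex set is allowed, so that symmetric differences of sides are covered.\<close>

lemma card_boundary_ne_2:
  assumes X: "X \<subseteq> verts G"
  shows "card (boundary G X) \<noteq> 2"
proof
  assume "card (boundary G X) = 2"
  then obtain e f where B: "boundary G X = {e, f}" "e \<noteq> f" by (auto simp: card_2_iff)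
  have ne: "X \<noteq> verts G" "X \<noteq> {}" using B boundary_verts[OF pseudo] boundary_empty[of G] by auto
  obtain c1 :: "'e \<Rightarrow> nat" where c1: "\<And>v. v \<in> X \<Longrightarrow> good_at G c1 v" "c1 e = c1 f"
    using extension_2[OF X ne(1) B] by blast
  obtain c2 :: "'e \<Rightarrow> nat" where c2: "\<And>v. v \<in> verts G - X \<Longrightarrow> good_at G c2 v" "c2 e = c2 f"
    by (rule extension_2[of "verts G - X"]) (use X ne B boundary_compl[OF pseudo, of X] in auto)
  have "has_41_coloring G"
    by (rule has_41_coloring_glue[OF pseudo, of X c1 c2]) (use c1 c2 B in auto)
  with no_coloring show False by simp
qed

lemma side_card:
  assumes "X \<subseteq> verts G" "X \<noteq> {}" "card X \<noteq> 1"
  shows "card X \<ge> 2"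
proof -
  have "card X \<noteq> 0" using assms finite_subset[OF assms(1) pseudographD(1)[OF pseudo]] by simp
  with assms(3) show ?thesis by simp
qed

text \<open>A single boundary edge has only one equality pattern, so two sides with at least two
  vertices each would glue by \<open>extension_1\<close>.\<close>

lemma boundary_1_imp_singleton:
  assumes X: "X \<subseteq> verts G" and B: "boundary G X = {e}"
  shows "card X = 1 \<or> card (verts G - X) = 1"
proof (rule ccontr)
  assume not: "\<not> ?thesis"
  have compl: "verts G - (verts G - X) = X" using X by auto
  have ne: "X \<noteq> {}" "verts G - X \<noteq> {}"
    using B X boundary_verts[OF pseudo] boundary_empty[of G] by auto
  have ge: "card X \<ge> 2" "card (verts G - X) \<ge> 2"
    using side_card[OF X ne(1)] side_card[OF Diff_subset ne(2)] not by simp_all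
  obtain c1 :: "'e \<Rightarrow> nat" where "\<And>v. v \<in> X \<Longrightarrow> good_at G c1 v"
    using extension_1[OF X ge(2) B] by blast
  moreover obtain c2 :: "'e \<Rightarrow> nat" where "\<And>v. v \<in> verts G - X \<Longrightarrow> good_at G c2 v"
    by (rule extension_1[of "verts G - X" e])
      (use ge B boundary_compl[OF pseudo, of X] compl in auto)
  ultimately have "has_41_coloring G"
    by (rule has_41_coloring_glue[OF pseudo]) (use B in auto)
  with no_coloring show False by simp
qed

text \<open>If both sides have at least two vertices, the gadgets of \<open>extension_3\<close> are
  available on both, and they always produce a common pattern to glue along.\<close>

lemma boundary_3_imp_singleton:
  assumes X: "X \<subseteq> verts G" and B: "card (boundary G X) = 3"
  shows "card X = 1 \<or> card (verts G - X) = 1"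
proof (rule ccontr)
  assume not: "\<not> ?thesis"
  define Y where "Y = verts G - X"
  have Y: "Y \<subseteq> verts G" "verts G - Y = X" "boundary G Y = boundary G X"
    using X boundary_compl[OF pseudo] by (auto simp: Y_def)
  have ne: "X \<noteq> {}" "Y \<noteq> {}"
    using B Y boundary_verts[OF pseudo] boundary_empty[of G] by auto
  have ge: "card X \<ge> 2" "card Y \<ge> 2"
    using side_card[of X] side_card[of Y] X Y ne not by (auto simp: Y_def)
  let ?ext = "\<lambda>X c. \<forall>v\<in>X. good_at G (c :: 'e \<Rightarrow> nat) v"
  let ?const = "\<lambda>X. \<exists>c. ?ext X c \<and> (\<forall>e\<in>boundary G X. \<forall>f\<in>boundary G X. c e = c f)"
  have glue: False
    if "?ext X c1" "?ext Y c2"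
      "\<And>e f. e \<in> boundary G X \<Longrightarrow> f \<in> boundary G X \<Longrightarrow> c1 e = c1 f \<longleftrightarrow> c2 e = c2 f" for c1 c2
  proof -
    have "has_41_coloring G"
      by (rule has_41_coloring_glue[OF pseudo, of X c1 c2]) (use that in \<open>auto simp: Y_def\<close>)
    then show False using no_coloring by simp
  qed
  \<comment> \<open>A side \<open>A\<close> without a constant pattern is adapted to whichever
    pattern with exactly two equal colours the other side \<open>A'\<close> offers.\<close>
  have match: "\<exists>c1 c2. ?ext A c1 \<and> ?ext A' c2 \<and>
      (\<forall>e\<in>boundary G X. \<forall>f\<in>boundary G X. c1 e = c1 f \<longleftrightarrow> c2 e = c2 f)"
    if A: "A \<subseteq> verts G" "A' = verts G - A" "boundary G A = boundary G X"
      "card A \<ge> 2" "card A' \<ge> 2" and nc: "\<not> ?const A" for A A'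
  proof -
    have A': "A' \<subseteq> verts G" "verts G - A' = A" "boundary G A' = boundary G X"
      using A boundary_compl[OF pseudo, of A] by auto
    obtain e f g where efg: "boundary G X = {e, f, g}" "e \<noteq> f" "e \<noteq> g" "f \<noteq> g"
      using B by (auto simp: card_3_iff)
    obtain c where c: "?ext A' c" "c e = c f \<and> c e \<noteq> c g \<or> c e = c g \<and> c e \<noteq> c f \<or> c f = c g \<and> c e \<noteq> c f"
      using extension_3(2)[of A' e f g] A' A(4) efg by auto
    \<comment> \<open>Relabelling makes \<open>e\<close> and \<open>f\<close> the pair that agrees
      in the colouring of \<open>A'\<close>.\<close>
    obtain e f g where efg: "boundary G X = {e, f, g}" "e \<noteq> f" "e \<noteq> g" "f \<noteq> g"
      and c': "c e = c f" "c e \<noteq> c g"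
    proof -
      from c(2) consider "c e = c f" "c e \<noteq> c g" | "c e = c g" "c e \<noteq> c f" | "c f = c g" "c f \<noteq> c e"
        by metis
      then show thesis
      proof cases
        case 1
        then show ?thesis using efg that by blast
      next
        case 2
        then show ?thesis using efg that[of e g f] by auto
      next
        case 3
        then show ?thesis using efg that[of f g e] by auto
      qed
    qed
    obtain d where d: "?ext A d" "d e = d f"
      using extension_3(1)[of A e f g] A efg by auto
    have "d g \<noteq> d e"
    proof
      assume "d g = d e"
      then have "\<forall>e\<in>boundary G A. \<forall>f\<in>boundary G A. d e = d f"
        using d(2) efg A(3) by auto
      with nc d(1) show False by blast
    qed
    then show ?thesis
      using d c(1) c' efg by (intro exI[of _ d] exI[of _ c]) auto
  qed
  show False
  proof (cases "?const X")
    case cX: True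
    show False
    proof (cases "?const Y")
      case True
      then obtain c2 where c2: "?ext Y c2" "\<forall>e\<in>boundary G X. \<forall>f\<in>boundary G X. c2 e = c2 f"
        unfolding Y(3) by blast
      obtain c1 where c1: "?ext X c1" "\<forall>e\<in>boundary G X. \<forall>f\<in>boundary G X. c1 e = c1 f"
        using cX by blast
      show False by (rule glue[OF c1(1) c2(1)]) (use c1(2) c2(2) in blast)
    next
      case False
      have "\<exists>c1 c2. ?ext Y c1 \<and> ?ext X c2 \<and>
          (\<forall>e\<in>boundary G X. \<forall>f\<in>boundary G X. c1 e = c1 f \<longleftrightarrow> c2 e = c2 f)"
        by (rule match[OF Y(1) Y(2)[symmetric] Y(3) ge(2,1) False])
      then obtain c1 c2 where "?ext Y c1" "?ext X c2"
        "\<forall>e\<in>boundary G X. \<forall>f\<in>boundary G X. c1 e = c1 f \<longleftrightarrow> c2 e = c2 f"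
        by blast
      then show False by (intro glue[of c2 c1]) blast+
    qed
  next
    case False
    have "\<exists>c1 c2. ?ext X c1 \<and> ?ext Y c2 \<and>
        (\<forall>e\<in>boundary G X. \<forall>f\<in>boundary G X. c1 e = c1 f \<longleftrightarrow> c2 e = c2 f)"
      by (rule match[OF X Y_def refl ge False])
    then obtain c1 c2 where "?ext X c1" "?ext Y c2"
      "\<forall>e\<in>boundary G X. \<forall>f\<in>boundary G X. c1 e = c1 f \<longleftrightarrow> c2 e = c2 f"
      by blast
    then show False by (intro glue[of c1 c2]) blast+
  qed
qed

section \<open>Bridges and minimal cuts of three edges\<close>

lemma card_loops_at_5:
  assumes "v \<in> verts G"
  shows "card (boundary G {v}) + 2 * card (loops_at G v) = 5"
  using card_loops_at[OF pseudo assms] reg assms by (simp add: regular_def)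

lemma singleton_sideE:
  assumes "X \<subseteq> verts G" "card X = 1 \<or> card (verts G - X) = 1"
  obtains v where "v \<in> verts G" "boundary G {v} = boundary G X"
    "X = {v} \<or> verts G - X = {v}"
proof -
  from assms(2) consider v where "X = {v}" | v where "verts G - X = {v}"
    by (auto simp: card_1_singleton_iff)
  then show thesis
  proof cases
    case 1
    then show ?thesis using assms(1) that[of v] by simp
  next
    case 2
    then have "v \<in> verts G" by blast
    then show ?thesis using 2 boundary_compl[OF pseudo, of X] that[of v] by simp
  qed
qed

lemma boundary_singleton_ends:
  assumes "e \<in> boundary G {v}"
  shows "v \<in># ends G e"
  using assms by (auto simp: boundary_def)

lemma no_two_bridges:
  assumes "bridge G e" "bridge G f"
  shows "e = f"
proof (rule ccontr)
  assume ne: "e \<noteq> f"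
  obtain X where X: "X \<subseteq> verts G" "boundary G X = {e}"
    by (rule bridgeE[OF pseudo assms(1)]) blast
  obtain Y where Y: "Y \<subseteq> verts G" "boundary G Y = {f}"
    by (rule bridgeE[OF pseudo assms(2)]) blast
  have "boundary G (sym_diff X Y) = {e, f}"
    using X Y ne by (auto simp: boundary_sym_diff[OF pseudo])
  then show False
    using card_boundary_ne_2[of "sym_diff X Y"] X Y ne by auto
qed

text \<open>A bridge cuts off a single vertex, at which the other four units of degree come from two
  loops. If both ends had two loops, they would be the whole graph and the bridge a perfect matching
  of it.\<close>

lemma bridge_end_loops:
  assumes e: "bridge G e"
  shows "\<exists>!v. v \<in># ends G e \<and> card (loops_at G v) = 2"
proof -
  obtain X where X: "X \<subseteq> verts G" "boundary G X = {e}"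
    by (rule bridgeE[OF pseudo e]) blast
  obtain v where v: "v \<in> verts G" "boundary G {v} = {e}"
    by (rule singleton_sideE[OF X(1) boundary_1_imp_singleton[OF X]]) (simp add: X(2))
  have eE: "e \<in> edges G" using v(2) boundary_subset[of G "{v}"] by auto
  show ?thesis
  proof (rule ex1I[of _ v])
    show "v \<in># ends G e \<and> card (loops_at G v) = 2"
      using boundary_singleton_ends[of e v] card_loops_at_5[OF v(1)] v(2) by auto
  next
    fix w assume w: "w \<in># ends G e \<and> card (loops_at G w) = 2"
    then have wV: "w \<in> verts G" using pseudographD(4)[OF pseudo eE] by auto
    show "w = v"
    proof (rule ccontr)
      assume ne: "w \<noteq> v"
      obtain x y where xy: "ends G e = {#x, y#}" using pseudographD(5)[OF pseudo eE] by blast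
      have vin: "v \<in># ends G e" using boundary_singleton_ends[of e v] v(2) by auto
      have "e \<in> boundary G {w}"
        using w vin ne xy by (auto simp: boundary_iff[OF eE xy])
      moreover have "card (boundary G {w}) = 1" using card_loops_at_5[OF wV] w by simp
      ultimately have "boundary G {w} = {e}" by (auto simp: card_1_singleton_iff)
      \<comment> \<open>Each end has boundary exactly \<open>{e}\<close>, so the two together have
        none, and by \<open>boundary_nonempty\<close> they are all vertices.\<close>
      then have "boundary G (sym_diff {v} {w}) = {}"
        using v(2) unfolding boundary_sym_diff[OF pseudo] by simp
      moreover have "sym_diff {v} {w} = {v, w}" using ne by auto
      ultimately have V: "verts G = {v, w}"
        using boundary_nonempty[of "{v, w}"] v(1) wV by auto
      have "has_41_coloring G"
      proof (rule has_41_coloring_if_matching[OF pseudo reg, of "{e}"])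
        fix u assume "u \<in> verts G"
        then show "(\<Sum>e\<in>{e}. count (ends G e) u) = 1"
          using V w vin ne xy by auto
      qed (use eE in simp)
      with no_coloring show False by simp
    qed
  qed
qed

text \<open>The cut is the boundary of one vertex, and the two units of degree beyond its three
  edges come from a loop.\<close>

lemma minimal_3_cut_common_vertex:
  assumes S: "minimal_edge_cut G S" "card S = 3"
  shows "\<exists>v. (\<forall>e\<in>S. v \<in># ends G e) \<and> loops_at G v \<noteq> {}"
proof -
  obtain X where X: "X \<subseteq> verts G" "boundary G X = S"
    by (rule minimal_edge_cutE[OF pseudo S(1)]) blast
  obtain v where v: "v \<in> verts G" "boundary G {v} = S"
    by (rule singleton_sideE[OF X(1) boundary_3_imp_singleton[OF X(1)]]) (simp_all add: X(2) S(2))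
  have "card (loops_at G v) = 1" using card_loops_at_5[OF v(1)] v(2) S(2) by simp
  then have "loops_at G v \<noteq> {}" by auto
  then show ?thesis using boundary_singleton_ends v(2) by blast
qed

section \<open>A cut of at most three edges from a Tutte barrier\<close>

lemma handshake: "5 * card (verts G) = 2 * card (inner_edges G (verts G))"
  using sum_degree[OF pseudo subset_refl] reg boundary_verts[OF pseudo]
  by (simp add: regular_def)

lemma even_card_verts: "even (card (verts G))"
  using handshake by presburger

text \<open>
  A Tutte barrier \<open>S\<close> sends at most \<open>5 |S|\<close> edges to its more than \<open>|S|\<close> odd classes, so one of
  them receives fewer than five.
\<close>

lemma small_boundary:
  obtains C where "C \<subseteq> verts G" "C \<noteq> {}" "C \<noteq> verts G" "card (boundary G C) \<le> 3"
proof -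
  have no_pm: "\<nexists>f. perfect_matching (adjacency G) (verts G) f"
    using has_41_coloring_if_perfect_matching[OF pseudo reg] no_coloring by blast
  obtain S P where S: "S \<subseteq> verts G" and P: "partition_on (verts G - S) P"
    and less: "card S < card {C \<in> P. odd (card C)}"
    and sep: "\<And>C D x y. C \<in> P \<Longrightarrow> D \<in> P \<Longrightarrow> C \<noteq> D \<Longrightarrow> x \<in> C \<Longrightarrow> y \<in> D \<Longrightarrow> (x, y) \<notin> adjacency G"
    by (rule tutte[OF pseudographD(1)[OF pseudo] even_card_verts sym_adjacency no_pm]) (rule that)
  define Od where "Od = {C \<in> P. odd (card C)}"
  have finV: "finite (verts G)" and finE: "finite (edges G)"
    using pseudographD[OF pseudo] by auto
  have finP: "finite P" using finite_elements[OF _ P] finV by auto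
  then have finOd: "finite Od" by (simp add: Od_def)
  have CV: "C \<subseteq> verts G - S" if "C \<in> P" for C using partition_onD1[OF P] that by auto
  \<comment> \<open>The end outside \<open>C\<close> cannot lie in another class, since no edge
    joins different classes; so it lies in \<open>S\<close>.\<close>
  have end_S: "\<exists>x y. ends G e = {#x, y#} \<and> x \<in> C \<and> y \<in> S" if C: "C \<in> P" and e: "e \<in> boundary G C" for C e
  proof -
    have "C \<subseteq> verts G" using CV[OF C] by auto
    with e obtain x y where xy: "ends G e = {#x, y#}" "x \<in> C" "y \<in> verts G - C"
      by (rule boundary_edgeE[OF pseudo])
    have "(x, y) \<in> adjacency G"
      using xy(1) e boundary_subset[of G C] by (auto simp: adjacency_def)
    then have "y \<notin> D" if "D \<in> P" for D
      using sep[OF C that _ xy(2)] xy(3) by auto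
    then have "y \<in> S" using xy(3) partition_onD1[OF P] by auto
    with xy show ?thesis by blast
  qed
  \<comment> \<open>A common edge would have one end in \<open>C\<close> and one in
    \<open>S\<close>, leaving none for \<open>D\<close>.\<close>
  have disj: "boundary G C \<inter> boundary G D = {}" if CD: "C \<in> P" "D \<in> P" "C \<noteq> D" for C D
  proof (rule ccontr)
    assume "boundary G C \<inter> boundary G D \<noteq> {}"
    then obtain e where e: "e \<in> boundary G C" "e \<in> boundary G D" by blast
    obtain x y where xy: "ends G e = {#x, y#}" "x \<in> C" "y \<in> S"
      using end_S[OF CD(1) e(1)] by blast
    obtain x' y' where xy': "ends G e = {#x', y'#}" "x' \<in> D" "y' \<in> S"
      using end_S[OF CD(2) e(2)] by blast
    have "C \<inter> D = {}" using partition_onD2[OF P] CD by (auto simp: disjoint_def)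
    moreover have "x' = x \<or> x' = y" using xy(1) xy'(1) by (auto simp: add_eq_conv_ex)
    ultimately show False using xy xy' CV[OF CD(2)] by blast
  qed
  have "(\<Sum>C\<in>Od. card (boundary G C)) = card (\<Union>C\<in>Od. boundary G C)"
  proof (rule card_UN_disjoint[symmetric, OF finOd])
    show "\<forall>C\<in>Od. finite (boundary G C)"
      using finite_subset[OF boundary_subset finE] by blast
    show "\<forall>C\<in>Od. \<forall>D\<in>Od. C \<noteq> D \<longrightarrow> boundary G C \<inter> boundary G D = {}"
      using disj by (auto simp: Od_def)
  qed
  also have "\<dots> \<le> card (\<Union>v\<in>S. {e \<in> edges G. v \<in># ends G e})"
  proof (rule card_mono)
    show "finite (\<Union>v\<in>S. {e \<in> edges G. v \<in># ends G e})"
      using finE finite_subset[OF S finV] by auto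
    show "(\<Union>C\<in>Od. boundary G C) \<subseteq> (\<Union>v\<in>S. {e \<in> edges G. v \<in># ends G e})"
    proof
      fix e assume "e \<in> (\<Union>C\<in>Od. boundary G C)"
      then obtain C where C: "C \<in> P" "e \<in> boundary G C" by (auto simp: Od_def)
      then obtain x y where "ends G e = {#x, y#}" "y \<in> S" using end_S by blast
      then show "e \<in> (\<Union>v\<in>S. {e \<in> edges G. v \<in># ends G e})"
        using C(2) boundary_subset[of G C] by auto
    qed
  qed
  also have "\<dots> \<le> (\<Sum>v\<in>S. card {e \<in> edges G. v \<in># ends G e})"
    by (rule card_UN_le[OF finite_subset[OF S finV]])
  also have "\<dots> \<le> (\<Sum>v\<in>S. 5)"
  proof (rule sum_mono)
    fix v assume "v \<in> S"
    have "card {e \<in> edges G. v \<in># ends G e} = (\<Sum>e\<in>{e \<in> edges G. v \<in># ends G e}. 1)" by simp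
    also have "\<dots> \<le> (\<Sum>e\<in>{e \<in> edges G. v \<in># ends G e}. count (ends G e) v)"
      by (rule sum_mono) (auto simp: Suc_le_eq)
    also have "\<dots> \<le> degree G v"
      unfolding degree_def by (rule sum_mono2[OF finE]) auto
    also have "\<dots> = 5" using reg S \<open>v \<in> S\<close> by (auto simp: regular_def)
    finally show "card {e \<in> edges G. v \<in># ends G e} \<le> 5" .
  qed
  finally have "(\<Sum>C\<in>Od. card (boundary G C)) \<le> 5 * card S" by simp
  also have "\<dots> < (\<Sum>C\<in>Od. 5)" using less by (simp add: Od_def)
  finally obtain C where C: "C \<in> Od" "card (boundary G C) < 5"
    by (metis not_le sum_mono)
  have CsubV: "C \<subseteq> verts G" and oddC: "odd (card C)"
    using C(1) CV by (auto simp: Od_def)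
  have "(\<Sum>v\<in>C. degree G v) = 5 * card C"
    using reg CsubV by (simp add: regular_def subset_iff)
  then have "5 * card C = card (boundary G C) + 2 * card (inner_edges G C)"
    using sum_degree[OF pseudo CsubV] by simp
  \<comment> \<open>Five times an odd number is odd and the inner edges contribute an even amount;
    an odd boundary of fewer than five edges has at most three.\<close>
  with oddC have "odd (card (boundary G C))" by presburger
  with C(2) have "card (boundary G C) \<le> 3" by presburger
  \<comment> \<open>Both the empty set and the vertex set have even size, so an odd class is
    neither.\<close>
  moreover have "C \<noteq> {}" "C \<noteq> verts G" using oddC even_card_verts by auto
  ultimately show thesis using that CsubV by blast
qed

text \<open>The small boundary may have fewer than three edges; adding further edges to the deleted
  set keeps the graph disconnected and brings the size to exactly three.\<close>

lemma three_edge_cut: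
  "\<not> edge_connected 4 G" "\<exists>S. edge_cut G S \<and> card S = 3"
proof -
  obtain C where C: "C \<subseteq> verts G" "C \<noteq> {}" "C \<noteq> verts G" "card (boundary G C) \<le> 3"
    by (rule small_boundary)
  have disconnected: "\<not> connected_graph (delete_edges G S)" if "boundary G C \<subseteq> S" for S
    using C that by (auto simp: connected_delete_edges_iff[OF pseudo])
  then show "\<not> edge_connected 4 G"
    using C(4) boundary_subset[of G C] unfolding edge_connected_def by fastforce
  \<comment> \<open>By the handshake identity a nonempty graph has at least \<open>5/2\<close>
    edges, hence three, so there are enough edges to enlarge the boundary.\<close>
  have "card (verts G) \<noteq> 0" using pseudographD[OF pseudo] by simp
  then have "3 \<le> card (inner_edges G (verts G))" using handshake by linarith
  also have "\<dots> \<le> card (edges G)"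
    by (rule card_mono[OF pseudographD(3)[OF pseudo] inner_edges_subset])
  finally obtain S where "boundary G C \<subseteq> S" "S \<subseteq> edges G" "card S = 3"
    using exists_subset_between[OF C(4) _ boundary_subset pseudographD(3)[OF pseudo]] by blast
  then show "\<exists>S. edge_cut G S \<and> card S = 3"
    using disconnected connected by (auto simp: edge_cut_def)
qed

end

theorem theorem5:
  fixes G :: "('v, 'e) pgraph"
  assumes "pseudograph G"
    and "regular 5 G"
    and "\<not> has_41_coloring G"
    and "\<And>H :: (nat, nat) pgraph.
           pseudograph H \<Longrightarrow> regular 5 H \<Longrightarrow> card (verts H) < card (verts G) \<Longrightarrow> has_41_coloring H"
  shows "connected_graph G
    \<and> (\<not> edge_connected 4 G \<and> (\<exists>S. edge_cut G S \<and> card S = 3))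
    \<and> \<not> (\<exists>S. minimal_edge_cut G S \<and> card S = 2)
    \<and> \<not> (\<exists>e f. e \<noteq> f \<and> bridge G e \<and> bridge G f)
    \<and> (\<forall>e. bridge G e \<longrightarrow> (\<exists>!v. v \<in># ends G e \<and> card (loops_at G v) = 2))
    \<and> (\<forall>S. minimal_edge_cut G S \<and> card S = 3 \<longrightarrow>
          (\<exists>v. (\<forall>e\<in>S. v \<in># ends G e) \<and> loops_at G v \<noteq> {}))"
proof -
  interpret minimal_counterexample G
    using assms by unfold_locales
  have "card S \<noteq> 2" if "minimal_edge_cut G S" for S
    by (rule minimal_edge_cutE[OF assms(1) that]) (use card_boundary_ne_2 in blast)
  then show ?thesis
    using connected three_edge_cut no_two_bridges bridge_end_loops minimal_3_cut_common_vertex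
    by blast
qed

end
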